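(* (Probabilistic Soundness Theorem) Let $\varphi,\psi$ be formulas of independence logic (with new-sort quantifiers). If $\varphi$ entails $\psi$ by repeated applications of the rules listed in the context, then $\varphi\models\psi$ in probabilistic team semantics (where $\perp$ is read as the probabilistic conditional independence atom $\perp\!\!\!\perp$).
   Context: Syntax. A vocabulary $\tau$ consists of a set $S_\tau\subseteq\mathbb{N}$ of sorts and sorted relation symbols; each variable $v$ has a sort $\mathrm{sort}(v)\in\mathbb{N}$. The $\tau$-formulas are: literals $u=v$, $\neg u=v$ ($u,v$ of the same sort), $R(\vec{x})$, $\neg R(\vec{x})$; independence atoms $\vec{y}\perp_{\vec{x}}\vec{z}$ for finite, possibly empty, tuples of variables of sorts in $S_\tau$; $\varphi\wedge\psi$, $\varphi\vee\psi$; $\exists v\varphi$, $\forall v\varphi$ with $\mathrm{sort}(v)\in S_\tau$; and $\tilde\exists v\varphi$, $\tilde\forall v\varphi$ where $\mathrm{sort}(v)\notin S_\tau$ and $\varphi$ is a formula of the vocabulary obtained from $\tau$ by adding the sort $\mathrm{sort}(v)$ (no new relation symbols) in which no variable of sort $\mathrm{sort}(v)$ other than $v$ occurs free. $=\!(\vec{x},\vec{y})$ abbreviates $\vec{y}\perp_{\vec{x}}\vec{y}$. Dependence logic is the fragment in which only independence atoms of the form $\vec{y}\perp_{\vec{x}}\vec{y}$ are allowed. Juxtaposition of tuples is concatenation. Probabilistic semantics. Probabilistic teams, and hence satisfaction, are defined only over finite structures: $\mathfrak{A}$ has a finite nonempty domain $A_n$ for each sort $n\in S_\tau$. An expansion of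 $\mathfrak{A}$ by a sort $n\notin S_\tau$ additionally has a nonempty domain $A_n$ and otherwise equals $\mathfrak{A}$. A probabilistic team of $\mathfrak{A}$ with variable domain $V$ (a finite set of variables of sorts in $S_\tau$) is a probability distribution $\mathbb{X}$ on the set of all assignments $s$ with domain $V$, $s(v)\in A_{\mathrm{sort}(v)}$. Its support (possibilistic collapse) is $\operatorname{supp}\mathbb{X}=\{s:\mathbb{X}(s)>0\}$, and $|\mathbb{X}_{\vec{u}=\vec{a}}|=\sum_{s(\vec{u})=\vec{a}}\mathbb{X}(s)$. $s(a/v)$ is $s$ modified or extended to map $v$ to $a$. For $r\in[0,1]$ and probabilistic teams $\mathbb{Y},\mathbb{Z}$ with the same variable and value domain, $(\mathbb{Y}\sqcup_r\mathbb{Z})(s)=r\mathbb{Y}(s)+(1-r)\mathbb{Z}(s)$. Put $\mathbb{X}[A_{\mathrm{sort}(v)}/v](s(a/v))=\sum_{t\in\operatorname{supp}\mathbb{X},\,t(a/v)=s(a/v)}\mathbb{X}(t)/|A_{\mathrm{sort}(v)}|$ and, for $F$ mapping each $s\in\operatorname{supp}\mathbb{X}$ to a probability distribution on $A_{\mathrm{sort}(v)}$, $\mathbb{X}[F/v](s(a/v))=\sum_{t\in\operatorname{supp}\mathbb{X},\,t(a/v)=s(a/v)}\mathbb{X}(t)F(t)(a)$. Satisfaction: a literal holds in $\mathbb{X}$ if all $s\in\operatorname{supp}\mathbb{X}$ satisfy it; $\vec{u}\perp\!\!\!\perp_{\vec{v}}\vec{w}$ holds if $|\mathbb{X}_{\vec{u}\vec{v}=\vec{a}\vec{b}}|\cdot|\mathbb{X}_{\vec{v}\vec{w}=\vec{b}\vec{c}}|=|\mathbb{X}_{\vec{u}\vec{v}\vec{w}=\vec{a}\vec{b}\vec{c}}|\cdot|\mathbb{X}_{\vec{v}=\vec{b}}|$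 for all $\vec{a},\vec{b},\vec{c}$; $\mathbb{X}\models\varphi\wedge\psi$ if $\mathbb{X}\models\varphi$ and $\mathbb{X}\models\psi$; $\mathbb{X}\models\varphi\vee\psi$ if $\mathbb{Y}\models\varphi$ and $\mathbb{Z}\models\psi$ for some probabilistic teams $\mathbb{Y},\mathbb{Z}$ and $r\in[0,1]$ such that $\mathbb{X}=\mathbb{Y}\sqcup_r\mathbb{Z}$; $\mathbb{X}\models\forall v\varphi$ if $\mathbb{X}[A_{\mathrm{sort}(v)}/v]\models\varphi$; $\mathbb{X}\models\exists v\varphi$ if $\mathbb{X}[F/v]\models\varphi$ for some $F$; $\mathfrak{A}\models_{\mathbb{X}}\tilde\forall v\varphi$ (resp. $\tilde\exists v\varphi$) if $\mathfrak{B}\models_{\mathbb{X}}\forall v\varphi$ for all (resp. $\mathfrak{B}\models_{\mathbb{X}}\exists v\varphi$ for some) expansions $\mathfrak{B}$ of $\mathfrak{A}$ by the sort $\mathrm{sort}(v)$. $\varphi\models\psi$ means: for all $\mathfrak{A}$ and all probabilistic teams $\mathbb{X}$ of $\mathfrak{A}$ whose variable domain contains the free variables, $\mathfrak{A}\models_{\mathbb{X}}\varphi$ implies $\mathfrak{A}\models_{\mathbb{X}}\psi$. Rules (entailment from a set $\Sigma$ of formulas being understood in the usual way). (I) Independence atom: Constancy: $\vec{y}\perp_{\vec{x}}\vec{y}$ entails $\vec{y}\perp_{\vec{x}}\vec{z}$. Reflexivity: $\vec{x}\perp_{\vec{x}}\vec{y}$. Symmetry: $\vec{z}\perp_{\vec{x}}\vec{y}$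 entails $\vec{y}\perp_{\vec{x}}\vec{z}$. Weakening: $\vec{y}y'\perp_{\vec{x}}\vec{z}z'$ entails $\vec{y}\perp_{\vec{x}}\vec{z}$. Permutation: each of the three tuples may be permuted. Fixed Parameter: $\vec{z}\perp_{\vec{x}}\vec{y}$ entails $\vec{y}\vec{x}\perp_{\vec{x}}\vec{z}\vec{x}$. First Transitivity: $\vec{x}\perp_{\vec{z}}\vec{y}\wedge\vec{u}\perp_{\vec{z}\vec{x}}\vec{y}$ entails $\vec{u}\perp_{\vec{z}}\vec{y}$. Second Transitivity: $\vec{y}\perp_{\vec{z}}\vec{y}\wedge\vec{z}\vec{x}\perp_{\vec{y}}\vec{u}$ entails $\vec{x}\perp_{\vec{z}}\vec{u}$. Exchange: $\vec{x}\perp_{\vec{z}}\vec{y}\wedge\vec{x}\vec{y}\perp_{\vec{z}}\vec{u}$ entails $\vec{x}\perp_{\vec{z}}\vec{y}\vec{u}$. (II) Dependence atom: $=\!(\vec{x}\vec{y},\vec{x})$; $=\!(\vec{x},\vec{y})\wedge=\!(\vec{y},\vec{z})$ entails $=\!(\vec{x},\vec{z})$; $=\!(\vec{x},\vec{y})$ entails $=\!(\vec{x},\vec{x}\vec{y})$; both tuples may be permuted. (III) Semigraphoid axioms: $\vec{x}\perp_{\vec{z}}\emptyset$; Symmetry; $\vec{x}\perp_{\vec{z}}\vec{y}\vec{w}$ entails $\vec{x}\perp_{\vec{z}}\vec{y}$ (Decomposition) and entails $\vec{x}\perp_{\vec{z}\vec{w}}\vec{y}$ (Weak Union); $\vec{x}\perp_{\vec{z}}\vec{y}\wedge\vec{x}\perp_{\vec{z}\vec{y}}\vec{w}$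 entails $\vec{x}\perp_{\vec{z}}\vec{y}\vec{w}$ (Contraction); Permutation; $\vec{x}\perp_{\vec{z}}\vec{y}$ entails $\vec{x}\vec{x}\perp_{\vec{z}\vec{z}}\vec{y}\vec{y}$ (Repetition). (IV) Logical rules: ($\exists$-elimination) if $\Sigma\cup\{\varphi\}$ entails $\psi$ and $x$ does not occur free in $\psi$ or in any member of $\Sigma$, then $\Sigma\cup\{\exists x\varphi\}$ entails $\psi$. ($\exists$-introduction) if $y$ does not occur in the scope of $Qx$ in $\varphi$ for any $Q\in\{\exists,\forall,\tilde\exists,\tilde\forall\}$, then $\varphi(y/x)$ (every free occurrence of $x$ in $\varphi$ replaced by $y$) entails $\exists x\varphi$. ($\wedge$) $\varphi\wedge\psi$ entails both $\varphi$ and $\psi$; $\{\varphi,\psi\}$ entails $\varphi\wedge\psi$. (Dependence introduction) $\exists x\varphi$ entails $\exists x(=\!(\vec{z},x)\wedge\varphi)$ whenever $\varphi$ is a formula of dependence logic, where $\vec{z}$ lists the free variables of $\exists x\varphi$. (First $\tilde\exists$-introduction) if no variable of sort $\mathrm{sort}(x)$ occurs in any formula of $\Sigma$ and $\Sigma$ entails $\exists x\varphi$, then $\Sigma$ entails $\tilde\exists x\varphi$. (Second $\tilde\exists$-introduction) if no variable of sort $\mathrm{sort}(x)$ occurs in any formula of $\Sigma$ and $\Sigma\cup\{\exists x\varphi\}$ entails $\exists y\psi$, where $\mathrm{sort}(y)=\mathrm{sort}(x)$, then $\Sigma\cup\{\tilde\exists x\varphi\}$ entails $\tilde\exists y\p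si$.
   Formalization: In ∃-introduction the side condition is replaced by: no free occurrence of x in φ lies in the scope of a quantifier binding y (x, y of the same sort). As printed the rule is unsound: ∀y y=y would entail ∃x∀y x=y. *)

theory Defs
  imports
    "HOL-Probability.Probability"
    "HOL-Library.Multiset"
    "HOL-Library.Infinite_Typeclass"
begin

section \<open>Syntax\<close>

datatype var = Var (vsort: nat) (vindex: nat)

record 'r vocab =
  sorts :: "nat set"
  arity :: "'r \<rightharpoonup> nat list"

definition is_vocab :: "'r vocab \<Rightarrow> bool" where
  "is_vocab \<tau> \<longleftrightarrow> (\<forall>ns\<in>ran (arity \<tau>). set ns \<subseteq> sorts \<tau>)"

definition add_sort :: "'r vocab \<Rightarrow> nat \<Rightarrow> 'r vocab" where
  "add_sort \<tau> n = \<tau>\<lparr>sorts := insert n (sorts \<tau>)\<rparr>"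

datatype 'r fm =
    Eq var var
  | Neq var var
  | Rel 'r "var list"
  | NRel 'r "var list"
  | Indep "var list" "var list" "var list"  ("_ \<perp>\<^bsub>_\<^esub> _" [61, 0, 61] 60)
  | Conj "'r fm" "'r fm"
  | Disj "'r fm" "'r fm"
  | Exi var "'r fm"
  | Uni var "'r fm"
  | NewExi var "'r fm"
  | NewUni var "'r fm"

abbreviation Dep :: "var list \<Rightarrow> var list \<Rightarrow> 'r fm" where
  "Dep xs ys \<equiv> ys \<perp>\<^bsub>xs\<^esub> ys"

primrec fv :: "'r fm \<Rightarrow> var set" where
  "fv (Eq u v) = {u, v}"
| "fv (Neq u v) = {u, v}"
| "fv (Rel R xs) = set xs"
| "fv (NRel R xs) = set xs"
| "fv (ys \<perp>\<^bsub>xs\<^esub> zs) = set ys \<union> set xs \<union> set zs"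
| "fv (Conj \<phi> \<psi>) = fv \<phi> \<union> fv \<psi>"
| "fv (Disj \<phi> \<psi>) = fv \<phi> \<union> fv \<psi>"
| "fv (Exi v \<phi>) = fv \<phi> - {v}"
| "fv (Uni v \<phi>) = fv \<phi> - {v}"
| "fv (NewExi v \<phi>) = fv \<phi> - {v}"
| "fv (NewUni v \<phi>) = fv \<phi> - {v}"

text \<open>All variables that occur, whether free, bound, or only next to a quantifier.\<close>

primrec occ :: "'r fm \<Rightarrow> var set" where
  "occ (Eq u v) = {u, v}"
| "occ (Neq u v) = {u, v}"
| "occ (Rel R xs) = set xs"
| "occ (NRel R xs) = set xs"
| "occ (ys \<perp>\<^bsub>xs\<^esub> zs) = set ys \<union> set xs \<union> set zs"
| "occ (Conj \<phi> \<psi>) = occ \<phi> \<union> occ \<psi>"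
| "occ (Disj \<phi> \<psi>) = occ \<phi> \<union> occ \<psi>"
| "occ (Exi v \<phi>) = insert v (occ \<phi>)"
| "occ (Uni v \<phi>) = insert v (occ \<phi>)"
| "occ (NewExi v \<phi>) = insert v (occ \<phi>)"
| "occ (NewUni v \<phi>) = insert v (occ \<phi>)"

primrec is_fm :: "'r fm \<Rightarrow> 'r vocab \<Rightarrow> bool" where
  "is_fm (Eq u v) \<tau> \<longleftrightarrow> vsort u \<in> sorts \<tau> \<and> vsort v = vsort u"
| "is_fm (Neq u v) \<tau> \<longleftrightarrow> vsort u \<in> sorts \<tau> \<and> vsort v = vsort u"
| "is_fm (Rel R xs) \<tau> \<longleftrightarrow> arity \<tau> R = Some (map vsort xs) \<and> vsort ` set xs \<subseteq> sorts \<tau>"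
| "is_fm (NRel R xs) \<tau> \<longleftrightarrow> arity \<tau> R = Some (map vsort xs) \<and> vsort ` set xs \<subseteq> sorts \<tau>"
| "is_fm (ys \<perp>\<^bsub>xs\<^esub> zs) \<tau> \<longleftrightarrow> vsort ` (set ys \<union> set xs \<union> set zs) \<subseteq> sorts \<tau>"
| "is_fm (Conj \<phi> \<psi>) \<tau> \<longleftrightarrow> is_fm \<phi> \<tau> \<and> is_fm \<psi> \<tau>"
| "is_fm (Disj \<phi> \<psi>) \<tau> \<longleftrightarrow> is_fm \<phi> \<tau> \<and> is_fm \<psi> \<tau>"
| "is_fm (Exi v \<phi>) \<tau> \<longleftrightarrow> vsort v \<in> sorts \<tau> \<and> is_fm \<phi> \<tau>"
| "is_fm (Uni v \<phi>) \<tau> \<longleftrightarrow> vsort v \<in> sorts \<tau> \<and> is_fm \<phi> \<tau>"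
| "is_fm (NewExi v \<phi>) \<tau> \<longleftrightarrow> vsort v \<notin> sorts \<tau> \<and> is_fm \<phi> (add_sort \<tau> (vsort v)) \<and>
     (\<forall>u\<in>fv \<phi>. vsort u = vsort v \<longrightarrow> u = v)"
| "is_fm (NewUni v \<phi>) \<tau> \<longleftrightarrow> vsort v \<notin> sorts \<tau> \<and> is_fm \<phi> (add_sort \<tau> (vsort v)) \<and>
     (\<forall>u\<in>fv \<phi>. vsort u = vsort v \<longrightarrow> u = v)"

primrec dependence_logic :: "'r fm \<Rightarrow> bool" where
  "dependence_logic (Eq u v) \<longleftrightarrow> True"
| "dependence_logic (Neq u v) \<longleftrightarrow> True"
| "dependence_logic (Rel R xs) \<longleftrightarrow> True"
| "dependence_logic (NRel R xs) \<longleftrightarrow> True"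
| "dependence_logic (ys \<perp>\<^bsub>xs\<^esub> zs) \<longleftrightarrow> ys = zs"
| "dependence_logic (Conj \<phi> \<psi>) \<longleftrightarrow> dependence_logic \<phi> \<and> dependence_logic \<psi>"
| "dependence_logic (Disj \<phi> \<psi>) \<longleftrightarrow> dependence_logic \<phi> \<and> dependence_logic \<psi>"
| "dependence_logic (Exi v \<phi>) \<longleftrightarrow> dependence_logic \<phi>"
| "dependence_logic (Uni v \<phi>) \<longleftrightarrow> dependence_logic \<phi>"
| "dependence_logic (NewExi v \<phi>) \<longleftrightarrow> dependence_logic \<phi>"
| "dependence_logic (NewUni v \<phi>) \<longleftrightarrow> dependence_logic \<phi>"

abbreviation repl :: "var \<Rightarrow> var \<Rightarrow> var \<Rightarrow> var" where
  "repl y x u \<equiv> (if u = x then y else u)"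

text \<open>\<open>subst y x \<phi>\<close> is \<open>\<phi>(y/x)\<close>: literal replacement of the free occurrences of \<open>x\<close> by \<open>y\<close>,
  without renaming of bound variables.\<close>

primrec subst :: "var \<Rightarrow> var \<Rightarrow> 'r fm \<Rightarrow> 'r fm" where
  "subst y x (Eq u v) = Eq (repl y x u) (repl y x v)"
| "subst y x (Neq u v) = Neq (repl y x u) (repl y x v)"
| "subst y x (Rel R xs) = Rel R (map (repl y x) xs)"
| "subst y x (NRel R xs) = NRel R (map (repl y x) xs)"
| "subst y x (us \<perp>\<^bsub>vs\<^esub> ws) = map (repl y x) us \<perp>\<^bsub>map (repl y x) vs\<^esub> map (repl y x) ws"
| "subst y x (Conj \<phi> \<psi>) = Conj (subst y x \<phi>) (subst y x \<psi>)"
| "subst y x (Disj \<phi> \<psi>) = Disj (subst y x \<phi>) (subst y x \<psi>)"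
| "subst y x (Exi v \<phi>) = Exi v (if v = x then \<phi> else subst y x \<phi>)"
| "subst y x (Uni v \<phi>) = Uni v (if v = x then \<phi> else subst y x \<phi>)"
| "subst y x (NewExi v \<phi>) = NewExi v (if v = x then \<phi> else subst y x \<phi>)"
| "subst y x (NewUni v \<phi>) = NewUni v (if v = x then \<phi> else subst y x \<phi>)"

text \<open>\<open>free_for y x \<phi>\<close>: no free occurrence of \<open>x\<close> in \<open>\<phi>\<close> lies in the scope of a quantifier
  binding \<open>y\<close>.\<close>

primrec free_for :: "var \<Rightarrow> var \<Rightarrow> 'r fm \<Rightarrow> bool" where
  "free_for y x (Eq u v) \<longleftrightarrow> True"
| "free_for y x (Neq u v) \<longleftrightarrow> True"
| "free_for y x (Rel R xs) \<longleftrightarrow> True"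
| "free_for y x (NRel R xs) \<longleftrightarrow> True"
| "free_for y x (us \<perp>\<^bsub>vs\<^esub> ws) \<longleftrightarrow> True"
| "free_for y x (Conj \<phi> \<psi>) \<longleftrightarrow> free_for y x \<phi> \<and> free_for y x \<psi>"
| "free_for y x (Disj \<phi> \<psi>) \<longleftrightarrow> free_for y x \<phi> \<and> free_for y x \<psi>"
| "free_for y x (Exi v \<phi>) \<longleftrightarrow> x \<notin> fv (Exi v \<phi>) \<or> v \<noteq> y \<and> free_for y x \<phi>"
| "free_for y x (Uni v \<phi>) \<longleftrightarrow> x \<notin> fv (Uni v \<phi>) \<or> v \<noteq> y \<and> free_for y x \<phi>"
| "free_for y x (NewExi v \<phi>) \<longleftrightarrow> x \<notin> fv (NewExi v \<phi>) \<or> v \<noteq> y \<and> free_for y x \<phi>"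
| "free_for y x (NewUni v \<phi>) \<longleftrightarrow> x \<notin> fv (NewUni v \<phi>) \<or> v \<noteq> y \<and> free_for y x \<phi>"


section \<open>Probabilistic team semantics\<close>

text \<open>Only the values of \<open>univ\<close> on the sorts, and of \<open>interp\<close> on the relation symbols, of the
  vocabulary at hand matter; the others are irrelevant to the satisfaction of its formulas.\<close>

record ('r, 'a) struct =
  univ :: "nat \<Rightarrow> 'a set"
  interp :: "'r \<Rightarrow> 'a list set"

definition is_struct :: "'r vocab \<Rightarrow> ('r, 'a) struct \<Rightarrow> bool" where
  "is_struct \<tau> \<AA> \<longleftrightarrow>
     (\<forall>n\<in>sorts \<tau>. finite (univ \<AA> n) \<and> univ \<AA> n \<noteq> {}) \<and>
     (\<forall>R ns. arity \<tau> R = Some ns \<longrightarrow> interp \<AA> R \<subseteq> {as. list_all2 (\<lambda>a n. a \<in> univ \<AA> n) as ns})"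

definition expand :: "('r, 'a) struct \<Rightarrow> nat \<Rightarrow> 'a set \<Rightarrow> ('r, 'a) struct" where
  "expand \<AA> n B = \<AA>\<lparr>univ := (univ \<AA>)(n := B)\<rparr>"

type_synonym 'a assignment = "var \<rightharpoonup> 'a"

definition assignments :: "('r, 'a) struct \<Rightarrow> var set \<Rightarrow> 'a assignment set" where
  "assignments \<AA> V = {s. dom s = V \<and> (\<forall>v\<in>V. the (s v) \<in> univ \<AA> (vsort v))}"

definition is_team :: "'r vocab \<Rightarrow> ('r, 'a) struct \<Rightarrow> var set \<Rightarrow> 'a assignment pmf \<Rightarrow> bool" where
  "is_team \<tau> \<AA> V X \<longleftrightarrow> finite V \<and> vsort ` V \<subseteq> sorts \<tau> \<and> set_pmf X \<subseteq> assignments \<AA> V"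

definition vals :: "'a assignment \<Rightarrow> var list \<Rightarrow> 'a list" where
  "vals s us = map (\<lambda>u. the (s u)) us"

definition weight :: "'a assignment pmf \<Rightarrow> var list \<Rightarrow> 'a list \<Rightarrow> real" where
  "weight X us as = measure_pmf.prob X {s. vals s us = as}"

definition cond_indep :: "'a assignment pmf \<Rightarrow> var list \<Rightarrow> var list \<Rightarrow> var list \<Rightarrow> bool" where
  "cond_indep X us vs ws \<longleftrightarrow>
     (\<forall>as bs cs. length as = length us \<and> length bs = length vs \<and> length cs = length ws \<longrightarrow>
        weight X (us @ vs) (as @ bs) * weight X (vs @ ws) (bs @ cs) =
        weight X (us @ vs @ ws) (as @ bs @ cs) * weight X vs bs)"

definition is_mixture :: "real \<Rightarrow> 'b pmf \<Rightarrow> 'b pmf \<Rightarrow> 'b pmf \<Rightarrow> bool" where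
  "is_mixture r X Y Z \<longleftrightarrow> (\<forall>s. pmf X s = r * pmf Y s + (1 - r) * pmf Z s)"

definition supplement ::
    "'a assignment pmf \<Rightarrow> ('a assignment \<Rightarrow> 'a pmf) \<Rightarrow> var \<Rightarrow> 'a assignment pmf" where
  "supplement X F v = bind_pmf X (\<lambda>t. map_pmf (\<lambda>a. t(v \<mapsto> a)) (F t))"

definition duplicate :: "'a assignment pmf \<Rightarrow> 'a set \<Rightarrow> var \<Rightarrow> 'a assignment pmf" where
  "duplicate X B v = supplement X (\<lambda>_. pmf_of_set B) v"

lemma pmf_supplement:
  assumes "finite (set_pmf X)"
  shows "pmf (supplement X F v) (s(v \<mapsto> a)) =
    (\<Sum>t\<in>{t\<in>set_pmf X. t(v \<mapsto> a) = s(v \<mapsto> a)}. pmf X t * pmf (F t) a)"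
proof -
  have eq: "pmf (map_pmf (\<lambda>b. t(v \<mapsto> b)) (F t)) (s(v \<mapsto> a)) =
      (if t(v \<mapsto> a) = s(v \<mapsto> a) then pmf (F t) a else 0)" for t
  proof (cases "t(v \<mapsto> a) = s(v \<mapsto> a)")
    case True
    have "inj (\<lambda>b. t(v \<mapsto> b))"
      by (rule injI) (metis fun_upd_same option.inject)
    from pmf_map_inj'[OF this, of "F t" a] True show ?thesis by simp
  next
    case False
    have "s(v \<mapsto> a) \<noteq> t(v \<mapsto> b)" for b
      using False by (metis fun_upd_same option.inject)
    then have "s(v \<mapsto> a) \<notin> set_pmf (map_pmf (\<lambda>b. t(v \<mapsto> b)) (F t))" by auto
    then show ?thesis using False by (simp only: set_pmf_iff if_False not_not)
  qed
  have "pmf (supplement X F v) (s(v \<mapsto> a)) =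
      (\<Sum>t\<in>set_pmf X. pmf X t * (if t(v \<mapsto> a) = s(v \<mapsto> a) then pmf (F t) a else 0))"
    unfolding supplement_def pmf_bind eq
    by (subst integral_measure_pmf[OF assms]) (auto simp: set_pmf_iff)
  also have "\<dots> = (\<Sum>t\<in>{t\<in>set_pmf X. t(v \<mapsto> a) = s(v \<mapsto> a)}. pmf X t * pmf (F t) a)"
    by (rule sum.mono_neutral_cong_right) (use assms in auto)
  finally show ?thesis .
qed

lemma pmf_duplicate:
  assumes "finite (set_pmf X)" "finite B" "a \<in> B"
  shows "pmf (duplicate X B v) (s(v \<mapsto> a)) =
    (\<Sum>t\<in>{t\<in>set_pmf X. t(v \<mapsto> a) = s(v \<mapsto> a)}. pmf X t / card B)"
proof -
  have "pmf (pmf_of_set B) a = 1 / card B"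
    using assms by (subst pmf_of_set) auto
  then show ?thesis
    by (simp add: duplicate_def pmf_supplement[OF assms(1)])
qed

text \<open>In \<open>sat \<phi> \<AA> V X\<close>, the set \<open>V\<close> is the variable domain of \<open>X\<close>. In a split
  \<open>X = r Y + (1 - r) Z\<close> both \<open>Y\<close> and \<open>Z\<close> have to be teams with variable domain \<open>V\<close>, also
  when the coefficient of one of them is \<open>0\<close>. As teams exist only over finite structures, the
  new sorts are interpreted by finite sets.\<close>

primrec sat :: "'r fm \<Rightarrow> ('r, 'a) struct \<Rightarrow> var set \<Rightarrow> 'a assignment pmf \<Rightarrow> bool" where
  "sat (Eq u v) \<AA> V X \<longleftrightarrow> (\<forall>s\<in>set_pmf X. the (s u) = the (s v))"
| "sat (Neq u v) \<AA> V X \<longleftrightarrow> (\<forall>s\<in>set_pmf X. the (s u) \<noteq> the (s v))"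
| "sat (Rel R xs) \<AA> V X \<longleftrightarrow> (\<forall>s\<in>set_pmf X. vals s xs \<in> interp \<AA> R)"
| "sat (NRel R xs) \<AA> V X \<longleftrightarrow> (\<forall>s\<in>set_pmf X. vals s xs \<notin> interp \<AA> R)"
| "sat (us \<perp>\<^bsub>vs\<^esub> ws) \<AA> V X \<longleftrightarrow> cond_indep X us vs ws"
| "sat (Conj \<phi> \<psi>) \<AA> V X \<longleftrightarrow> sat \<phi> \<AA> V X \<and> sat \<psi> \<AA> V X"
| "sat (Disj \<phi> \<psi>) \<AA> V X \<longleftrightarrow>
     (\<exists>Y Z. \<exists>r\<in>{0..1}. set_pmf Y \<subseteq> assignments \<AA> V \<and> set_pmf Z \<subseteq> assignments \<AA> V \<and>
        is_mixture r X Y Z \<and> sat \<phi> \<AA> V Y \<and> sat \<psi> \<AA> V Z)"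
| "sat (Exi v \<phi>) \<AA> V X \<longleftrightarrow>
     (\<exists>F. (\<forall>s\<in>set_pmf X. set_pmf (F s) \<subseteq> univ \<AA> (vsort v)) \<and>
        sat \<phi> \<AA> (insert v V) (supplement X F v))"
| "sat (Uni v \<phi>) \<AA> V X \<longleftrightarrow> sat \<phi> \<AA> (insert v V) (duplicate X (univ \<AA> (vsort v)) v)"
| "sat (NewExi v \<phi>) \<AA> V X \<longleftrightarrow>
     (\<exists>B. finite B \<and> B \<noteq> {} \<and>
        (\<exists>F. (\<forall>s\<in>set_pmf X. set_pmf (F s) \<subseteq> univ (expand \<AA> (vsort v) B) (vsort v)) \<and>
           sat \<phi> (expand \<AA> (vsort v) B) (insert v V) (supplement X F v)))"
| "sat (NewUni v \<phi>) \<AA> V X \<longleftrightarrow>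
     (\<forall>B. finite B \<and> B \<noteq> {} \<longrightarrow>
        sat \<phi> (expand \<AA> (vsort v) B) (insert v V)
          (duplicate X (univ (expand \<AA> (vsort v) B) (vsort v)) v))"

lemma sat_NewExi:
  "sat (NewExi v \<phi>) \<AA> V X \<longleftrightarrow>
    (\<exists>B. finite B \<and> B \<noteq> {} \<and> sat (Exi v \<phi>) (expand \<AA> (vsort v) B) V X)"
  by simp

lemma sat_NewUni:
  "sat (NewUni v \<phi>) \<AA> V X \<longleftrightarrow>
    (\<forall>B. finite B \<and> B \<noteq> {} \<longrightarrow> sat (Uni v \<phi>) (expand \<AA> (vsort v) B) V X)"
  by simp

text \<open>The elements of structures are drawn from an arbitrary type \<open>'a\<close>; it has to be infinite so
  that the expansions by a new sort include domains of every finite cardinality.\<close>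

definition entails :: "'a::infinite itself \<Rightarrow> 'r vocab \<Rightarrow> 'r fm \<Rightarrow> 'r fm \<Rightarrow> bool" where
  "entails _ \<tau> \<phi> \<psi> \<longleftrightarrow>
     (\<forall>(\<AA> :: ('r, 'a) struct) V X. is_struct \<tau> \<AA> \<longrightarrow> is_team \<tau> \<AA> V X \<longrightarrow>
        fv \<phi> \<union> fv \<psi> \<subseteq> V \<longrightarrow> sat \<phi> \<AA> V X \<longrightarrow> sat \<psi> \<AA> V X)"


section \<open>The deduction system\<close>

inductive atom_axiom :: "'r fm \<Rightarrow> bool" where
  reflexivity: "atom_axiom (xs \<perp>\<^bsub>xs\<^esub> ys)"
| dep_reflexivity: "atom_axiom (Dep (xs @ ys) xs)"
| empty_independence: "atom_axiom (xs \<perp>\<^bsub>zs\<^esub> [])"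

inductive atom_rule :: "'r fm \<Rightarrow> 'r fm \<Rightarrow> bool" where
  constancy: "atom_rule (ys \<perp>\<^bsub>xs\<^esub> ys) (ys \<perp>\<^bsub>xs\<^esub> zs)"
| symmetry: "atom_rule (zs \<perp>\<^bsub>xs\<^esub> ys) (ys \<perp>\<^bsub>xs\<^esub> zs)"
| weakening: "atom_rule (ys @ [y'] \<perp>\<^bsub>xs\<^esub> zs @ [z']) (ys \<perp>\<^bsub>xs\<^esub> zs)"
| permutation: "mset ys' = mset ys \<Longrightarrow> mset xs' = mset xs \<Longrightarrow> mset zs' = mset zs \<Longrightarrow>
    atom_rule (ys \<perp>\<^bsub>xs\<^esub> zs) (ys' \<perp>\<^bsub>xs'\<^esub> zs')"
| fixed_parameter: "atom_rule (zs \<perp>\<^bsub>xs\<^esub> ys) (ys @ xs \<perp>\<^bsub>xs\<^esub> zs @ xs)"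
| first_transitivity:
    "atom_rule (Conj (xs \<perp>\<^bsub>zs\<^esub> ys) (us \<perp>\<^bsub>zs @ xs\<^esub> ys)) (us \<perp>\<^bsub>zs\<^esub> ys)"
| second_transitivity:
    "atom_rule (Conj (ys \<perp>\<^bsub>zs\<^esub> ys) (zs @ xs \<perp>\<^bsub>ys\<^esub> us)) (xs \<perp>\<^bsub>zs\<^esub> us)"
| exchange:
    "atom_rule (Conj (xs \<perp>\<^bsub>zs\<^esub> ys) (xs @ ys \<perp>\<^bsub>zs\<^esub> us)) (xs \<perp>\<^bsub>zs\<^esub> ys @ us)"
| dep_transitivity: "atom_rule (Conj (Dep xs ys) (Dep ys zs)) (Dep xs zs)"
| dep_augmentation: "atom_rule (Dep xs ys) (Dep xs (xs @ ys))"
| dep_permutation: "mset xs' = mset xs \<Longrightarrow> mset ys' = mset ys \<Longrightarrow>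
    atom_rule (Dep xs ys) (Dep xs' ys')"
| decomposition: "atom_rule (xs \<perp>\<^bsub>zs\<^esub> ys @ ws) (xs \<perp>\<^bsub>zs\<^esub> ys)"
| weak_union: "atom_rule (xs \<perp>\<^bsub>zs\<^esub> ys @ ws) (xs \<perp>\<^bsub>zs @ ws\<^esub> ys)"
| contraction:
    "atom_rule (Conj (xs \<perp>\<^bsub>zs\<^esub> ys) (xs \<perp>\<^bsub>zs @ ys\<^esub> ws)) (xs \<perp>\<^bsub>zs\<^esub> ys @ ws)"
| repetition: "atom_rule (xs \<perp>\<^bsub>zs\<^esub> ys) (xs @ xs \<perp>\<^bsub>zs @ zs\<^esub> ys @ ys)"

text \<open>\<open>derives \<tau> \<Sigma> \<phi>\<close> holds only if \<open>\<phi>\<close> and all members of \<open>\<Sigma>\<close> are formulas of \<open>\<tau>\<close>. The rules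
  introducing a new-sort quantifier pass from the vocabulary with the sort of the
  variable added to the one without it.

  The side condition of \<open>exi_intro\<close> is the one that keeps \<open>y\<close> from being captured. Without it,
  \<open>\<forall>y. y = y\<close>, which is \<open>(\<forall>y. x = y)(y/x)\<close>, would entail \<open>\<exists>x. \<forall>y. x = y\<close>.\<close>

inductive derives :: "'r vocab \<Rightarrow> 'r fm set \<Rightarrow> 'r fm \<Rightarrow> bool" where
  assumption: "\<forall>\<theta>\<in>\<Sigma>. is_fm \<theta> \<tau> \<Longrightarrow> \<phi> \<in> \<Sigma> \<Longrightarrow> derives \<tau> \<Sigma> \<phi>"
| monotonicity: "derives \<tau> \<Sigma> \<phi> \<Longrightarrow> \<Sigma> \<subseteq> \<Sigma>' \<Longrightarrow> \<forall>\<theta>\<in>\<Sigma>'. is_fm \<theta> \<tau> \<Longrightarrow> derives \<tau> \<Sigma>' \<phi>"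
| cut: "derives \<tau> \<Sigma> \<theta> \<Longrightarrow> derives \<tau> (insert \<theta> \<Sigma>) \<phi> \<Longrightarrow> derives \<tau> \<Sigma> \<phi>"
| by_atom_axiom: "\<forall>\<theta>\<in>\<Sigma>. is_fm \<theta> \<tau> \<Longrightarrow> atom_axiom \<phi> \<Longrightarrow> is_fm \<phi> \<tau> \<Longrightarrow> derives \<tau> \<Sigma> \<phi>"
| by_atom_rule: "derives \<tau> \<Sigma> \<phi> \<Longrightarrow> atom_rule \<phi> \<psi> \<Longrightarrow> is_fm \<psi> \<tau> \<Longrightarrow> derives \<tau> \<Sigma> \<psi>"
| exi_elim: "derives \<tau> (insert \<phi> \<Sigma>) \<psi> \<Longrightarrow> x \<notin> fv \<psi> \<Longrightarrow> \<forall>\<theta>\<in>\<Sigma>. x \<notin> fv \<theta> \<Longrightarrow>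
    is_fm (Exi x \<phi>) \<tau> \<Longrightarrow> derives \<tau> (insert (Exi x \<phi>) \<Sigma>) \<psi>"
| exi_intro: "derives \<tau> \<Sigma> (subst y x \<phi>) \<Longrightarrow> vsort y = vsort x \<Longrightarrow> free_for y x \<phi> \<Longrightarrow>
    is_fm (Exi x \<phi>) \<tau> \<Longrightarrow> derives \<tau> \<Sigma> (Exi x \<phi>)"
| conj_elim1: "derives \<tau> \<Sigma> (Conj \<phi> \<psi>) \<Longrightarrow> derives \<tau> \<Sigma> \<phi>"
| conj_elim2: "derives \<tau> \<Sigma> (Conj \<phi> \<psi>) \<Longrightarrow> derives \<tau> \<Sigma> \<psi>"
| conj_intro: "derives \<tau> \<Sigma> \<phi> \<Longrightarrow> derives \<tau> \<Sigma> \<psi> \<Longrightarrow> derives \<tau> \<Sigma> (Conj \<phi> \<psi>)"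
| dep_intro: "derives \<tau> \<Sigma> (Exi x \<phi>) \<Longrightarrow> dependence_logic \<phi> \<Longrightarrow> set zs = fv (Exi x \<phi>) \<Longrightarrow>
    derives \<tau> \<Sigma> (Exi x (Conj (Dep zs [x]) \<phi>))"
| new_exi_intro1: "derives (add_sort \<tau> (vsort x)) \<Sigma> (Exi x \<phi>) \<Longrightarrow>
    \<forall>\<theta>\<in>\<Sigma>. \<forall>u\<in>occ \<theta>. vsort u \<noteq> vsort x \<Longrightarrow>
    \<forall>\<theta>\<in>\<Sigma>. is_fm \<theta> \<tau> \<Longrightarrow> is_fm (NewExi x \<phi>) \<tau> \<Longrightarrow>
    derives \<tau> \<Sigma> (NewExi x \<phi>)"
| new_exi_intro2: "derives (add_sort \<tau> (vsort x)) (insert (Exi x \<phi>) \<Sigma>) (Exi y \<psi>) \<Longrightarrow>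
    vsort y = vsort x \<Longrightarrow> \<forall>\<theta>\<in>\<Sigma>. \<forall>u\<in>occ \<theta>. vsort u \<noteq> vsort x \<Longrightarrow>
    \<forall>\<theta>\<in>\<Sigma>. is_fm \<theta> \<tau> \<Longrightarrow> is_fm (NewExi x \<phi>) \<tau> \<Longrightarrow> is_fm (NewExi y \<psi>) \<tau> \<Longrightarrow>
    derives \<tau> (insert (NewExi x \<phi>) \<Sigma>) (NewExi y \<psi>)"

lemma derives_is_fm: "derives \<tau> \<Sigma> \<phi> \<Longrightarrow> (\<forall>\<theta>\<in>\<Sigma>. is_fm \<theta> \<tau>) \<and> is_fm \<phi> \<tau>"
proof (induction rule: derives.induct)
  case (dep_intro \<tau> \<Sigma> x \<phi> zs)
  have "vsort ` fv \<theta> \<subseteq> sorts \<sigma>" if "is_fm \<theta> \<sigma>" for \<theta> :: "'a fm" and \<sigma>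
    using that by (induction \<theta> arbitrary: \<sigma>) (fastforce simp: add_sort_def)+
  then show ?case using dep_intro by auto
qed auto

end

theory Submission
  imports Defs
begin

text \<open>
  Probabilistic independence atoms obey the semigraphoid axioms, and \<open>y \<perp> y | x\<close> says that on the
  support of the team \<open>y\<close> is a function of \<open>x\<close>; this gives the rules for atoms. The quantifier rules
  rest on locality: satisfaction depends only on the marginal distribution of the free variables.
  Teams with the same marginal are linked by a coupling, and disintegrating the coupling transports
  the witnesses of \<open>\<or>\<close> and \<open>\<exists>\<close> from one team to the other. The same argument covers
  capture-free renaming of variables and changing the domains of sorts that do not occur. Finally,
  formulas of dependence logic are preserved by every team with a smaller support, so a witness for
  \<open>\<exists>x\<close> can be replaced by one that is a function of the free variables.
\<close>

section \<open>Conditional independence of discrete random variables\<close>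

text \<open>One induction has to treat locality, substitution and change of domains together:
  passing under a quantifier enlarges the variable domain, resets the renaming at the bound variable
  and may expand the structure. Neither team is a function of the other, since each may carry
  variables that the formula does not see. The coupling is therefore read in both directions. For
  \<open>\<exists>\<close> a kernel leads from the target team back to the source, so that a choice
  can be pulled back and averaged; for \<open>\<or>\<close> a kernel leads from the source to the
  target, so that both components can be pushed forward. Downward closure alone does not justify
  dependence introduction: making the choice a function of the free variables can create assignments
  outside the old support. The inclusion holds only after restriction to the free variables of the
  scope, and locality bridges the gap. Independence is studied for arbitrary functions on a discrete
  space instead of tuples of variables: concatenation becomes pairing, and the order and repetition
  of variables disappear into the question of which function determines which.\<close>

definition ci :: "'s pmf \<Rightarrow> ('s \<Rightarrow> 'a) \<Rightarrow> ('s \<Rightarrow> 'b) \<Rightarrow> ('s \<Rightarrow> 'c) \<Rightarrow> bool" where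
  "ci X f g h \<longleftrightarrow> (\<forall>a b c.
     measure_pmf.prob X {s. f s = a \<and> g s = b} * measure_pmf.prob X {s. g s = b \<and> h s = c} =
     measure_pmf.prob X {s. f s = a \<and> g s = b \<and> h s = c} * measure_pmf.prob X {s. g s = b})"

lemma prob_cong_set_pmf:
  assumes "\<And>s. s \<in> set_pmf X \<Longrightarrow> P s \<longleftrightarrow> Q s"
  shows "measure_pmf.prob X {s. P s} = measure_pmf.prob X {s. Q s}"
  by (rule measure_prob_cong_0) (use assms in \<open>auto simp: pmf_eq_0_set_pmf\<close>)

lemma prob_mono_Collect:
  "(\<And>s. P s \<Longrightarrow> Q s) \<Longrightarrow> measure_pmf.prob X {s. P s} \<le> measure_pmf.prob X {s. Q s}"
  by (rule measure_pmf.finite_measure_mono) auto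

lemma prob_fiberwise:
  assumes "finite I" "\<And>s. s \<in> set_pmf X \<Longrightarrow> P s \<Longrightarrow> f s \<in> I"
  shows "measure_pmf.prob X {s. P s} = (\<Sum>i\<in>I. measure_pmf.prob X {s. f s = i \<and> P s})"
proof -
  have "(\<Sum>i\<in>I. measure_pmf.prob X {s. f s = i \<and> P s}) =
      measure_pmf.prob X (\<Union>i\<in>I. {s. f s = i \<and> P s})"
    by (rule measure_pmf.finite_measure_finite_Union[symmetric])
      (use assms in \<open>auto simp: disjoint_family_on_def\<close>)
  also have "(\<Union>i\<in>I. {s. f s = i \<and> P s}) = {s. f s \<in> I \<and> P s}" by auto
  also have "measure_pmf.prob X \<dots> = measure_pmf.prob X {s. P s}"
    by (rule prob_cong_set_pmf) (use assms(2) in auto)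
  finally show ?thesis ..
qed

lemma ci_sym: "ci X f g h \<Longrightarrow> ci X h g f"
  unfolding ci_def by (simp add: conj_commute conj_left_commute mult.commute)

lemma ci_refl: "ci X g g h"
  unfolding ci_def
proof (intro allI)
  fix a b c
  show "measure_pmf.prob X {s. g s = a \<and> g s = b} * measure_pmf.prob X {s. g s = b \<and> h s = c} =
    measure_pmf.prob X {s. g s = a \<and> g s = b \<and> h s = c} * measure_pmf.prob X {s. g s = b}"
  proof (cases "a = b")
    case False
    then have "{s. g s = a \<and> g s = b} = {}" "{s. g s = a \<and> g s = b \<and> h s = c} = {}" by auto
    then show ?thesis by (simp only: measure_empty)
  qed simp
qed

text \<open>Where \<open>g s = b\<close>, the event \<open>f' s = a\<close> splits, up to a null
  set, into finitely many events \<open>f s = i\<close>, and the defining equation is additive in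
  its first event. As \<open>f'\<close> may also use \<open>g\<close>, variables of the condition
  can later be added to an outer tuple.\<close>

lemma ci_map_left:
  assumes fin: "finite (set_pmf X)" and ci: "ci X f g h"
    and det: "\<And>s t. f s = f t \<Longrightarrow> g s = g t \<Longrightarrow> f' s = f' t"
  shows "ci X f' g h"
  unfolding ci_def
proof (intro allI)
  fix a b c
  let ?I = "f ` {s\<in>set_pmf X. f' s = a \<and> g s = b}"
  have sum: "measure_pmf.prob X {s. f' s = a \<and> g s = b \<and> E s} =
      (\<Sum>i\<in>?I. measure_pmf.prob X {s. f s = i \<and> g s = b \<and> E s})" for E
  proof -
    have "measure_pmf.prob X {s. f' s = a \<and> g s = b \<and> E s} =
        (\<Sum>i\<in>?I. measure_pmf.prob X {s. f s = i \<and> f' s = a \<and> g s = b \<and> E s})"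
      by (rule prob_fiberwise) (use fin in auto)
    also have "\<dots> = (\<Sum>i\<in>?I. measure_pmf.prob X {s. f s = i \<and> g s = b \<and> E s})"
    proof (rule sum.cong[OF refl])
      fix i assume "i \<in> ?I"
      then obtain t where "i = f t" "f' t = a" "g t = b" by auto
      then have "f' s = a" if "f s = i" "g s = b" for s
        using det[of s t] that by simp
      then have "{s. f s = i \<and> f' s = a \<and> g s = b \<and> E s} = {s. f s = i \<and> g s = b \<and> E s}"
        by auto
      then show "measure_pmf.prob X {s. f s = i \<and> f' s = a \<and> g s = b \<and> E s} =
        measure_pmf.prob X {s. f s = i \<and> g s = b \<and> E s}" by simp
    qed
    finally show ?thesis .
  qed
  show "measure_pmf.prob X {s. f' s = a \<and> g s = b} * measure_pmf.prob X {s. g s = b \<and> h s = c} =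
    measure_pmf.prob X {s. f' s = a \<and> g s = b \<and> h s = c} * measure_pmf.prob X {s. g s = b}"
    using ci sum[of "\<lambda>_. True"] sum[of "\<lambda>s. h s = c"]
    by (simp add: ci_def sum_distrib_right)
qed

lemma ci_map_right:
  assumes "finite (set_pmf X)" "ci X f g h"
    and "\<And>s t. h s = h t \<Longrightarrow> g s = g t \<Longrightarrow> h' s = h' t"
  shows "ci X f g h'"
  using ci_sym[OF ci_map_left[OF assms(1) ci_sym[OF assms(2)] assms(3)]] .

text \<open>Functions with the same kernel have the same nonempty fibres, and for a value that is
  never attained both sides of the equation are 0.\<close>

lemma ci_cong_condition:
  assumes ci: "ci X f g h" and eq: "\<And>s t. g s = g t \<longleftrightarrow> g' s = g' t"
  shows "ci X f g' h"
  unfolding ci_def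
proof (intro allI)
  fix a b c
  show "measure_pmf.prob X {s. f s = a \<and> g' s = b} * measure_pmf.prob X {s. g' s = b \<and> h s = c} =
    measure_pmf.prob X {s. f s = a \<and> g' s = b \<and> h s = c} * measure_pmf.prob X {s. g' s = b}"
  proof (cases "\<exists>t. g' t = b")
    case True
    then obtain t where "g' t = b" ..
    then have "g' s = b \<longleftrightarrow> g s = g t" for s using eq by metis
    then show ?thesis using ci by (simp add: ci_def)
  qed simp
qed

text \<open>Independence is stated with products instead of quotients, so conditional probabilities
  are compared by cross multiplication: \<open>a\<close> is the factor shared by two equations and
  to be eliminated, \<open>p\<close> the probability of a conditioning event.\<close>

lemma cross_mult_cancel:
  fixes p :: real
  assumes "p \<noteq> 0" "a * y = q * p" "a * z = w * p"
  shows "w * y = q * z"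
proof -
  have "p * (w * y) = (a * z) * y" using assms(3) by simp
  also have "\<dots> = (a * y) * z" by simp
  also have "\<dots> = p * (q * z)" using assms(2) by simp
  finally show ?thesis using assms(1) by simp
qed

text \<open>The equations for \<open>(h, k)\<close> and for \<open>k\<close> alone share the factor
  P(f = a, g = b). Eliminating it leaves the claim multiplied by P(g = b).\<close>

lemma ci_weak_union:
  assumes fin: "finite (set_pmf X)" and ci: "ci X f g (\<lambda>s. (h s, k s))"
  shows "ci X f (\<lambda>s. (g s, k s)) h"
proof -
  have ci': "ci X f g k"
    by (rule ci_map_right[OF fin ci]) auto
  show ?thesis
    unfolding ci_def
  proof (clarify, unfold prod.inject)
    fix a b d c
    let ?P = "measure_pmf.prob X"
    \<comment> \<open>These bounds settle the case in which \<open>g s = b\<close> is a null event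
      and nothing can be cancelled: each side then contains a factor 0.\<close>
    have le: "?P {s. f s = a \<and> g s = b \<and> k s = d} \<le> ?P {s. g s = b}"
      "?P {s. f s = a \<and> (g s = b \<and> k s = d) \<and> h s = c} \<le> ?P {s. g s = b}"
      by (rule prob_mono_Collect; simp)+
    have 1: "?P {s. f s = a \<and> g s = b} * ?P {s. (g s = b \<and> k s = d) \<and> h s = c} =
        ?P {s. f s = a \<and> (g s = b \<and> k s = d) \<and> h s = c} * ?P {s. g s = b}"
      using ci[unfolded ci_def, rule_format, of a b "(c, d)"]
      by (simp add: conj_commute conj_left_commute)
    have 2: "?P {s. f s = a \<and> g s = b} * ?P {s. g s = b \<and> k s = d} =
        ?P {s. f s = a \<and> g s = b \<and> k s = d} * ?P {s. g s = b}"
      using ci' by (simp add: ci_def)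
    show "?P {s. f s = a \<and> g s = b \<and> k s = d} * ?P {s. (g s = b \<and> k s = d) \<and> h s = c} =
      ?P {s. f s = a \<and> (g s = b \<and> k s = d) \<and> h s = c} * ?P {s. g s = b \<and> k s = d}"
    proof (cases "?P {s. g s = b} = 0")
      case True
      then show ?thesis using le by (simp add: measure_le_0_iff)
    next
      case False
      then show ?thesis by (rule cross_mult_cancel[OF _ 1 2])
    qed
  qed
qed

text \<open>The shared factor is now P(f = a, g = b, h = c), and P(g = b, h = c) is cancelled; if
  the latter is 0, each side contains the probability of a smaller event.\<close>

lemma ci_contraction:
  assumes ci: "ci X f g h" "ci X f (\<lambda>s. (g s, h s)) k"
  shows "ci X f g (\<lambda>s. (h s, k s))"
  unfolding ci_def
proof (clarify, unfold prod.inject)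
  fix a b c d
  let ?P = "measure_pmf.prob X"
  have le: "?P {s. f s = a \<and> g s = b \<and> h s = c \<and> k s = d} \<le> ?P {s. g s = b \<and> h s = c}"
    "?P {s. g s = b \<and> h s = c \<and> k s = d} \<le> ?P {s. g s = b \<and> h s = c}"
    by (rule prob_mono_Collect; simp)+
  have 1: "?P {s. f s = a \<and> g s = b} * ?P {s. g s = b \<and> h s = c} =
      ?P {s. f s = a \<and> g s = b \<and> h s = c} * ?P {s. g s = b}"
    using ci(1) by (simp add: ci_def)
  have 2: "?P {s. f s = a \<and> g s = b \<and> h s = c} * ?P {s. g s = b \<and> h s = c \<and> k s = d} =
      ?P {s. f s = a \<and> g s = b \<and> h s = c \<and> k s = d} * ?P {s. g s = b \<and> h s = c}"
    using ci(2)[unfolded ci_def, rule_format, of a "(b, c)" d] by simp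
  show "?P {s. f s = a \<and> g s = b} * ?P {s. g s = b \<and> h s = c \<and> k s = d} =
    ?P {s. f s = a \<and> g s = b \<and> h s = c \<and> k s = d} * ?P {s. g s = b}"
  proof (cases "?P {s. g s = b \<and> h s = c} = 0")
    case True
    then show ?thesis using le by (simp add: measure_le_0_iff)
  next
    case False
    then show ?thesis
      by (rule cross_mult_cancel[of _ "?P {s. f s = a \<and> g s = b \<and> h s = c}"])
        (use 1 2 in \<open>simp_all add: mult.commute\<close>)
  qed
qed

text \<open>Two support points with equal \<open>g\<close> and different \<open>f\<close> would make
  both factors on the left of the equation positive, while the joint event on the right asks for two
  values of \<open>f\<close> at once and is empty.\<close>

lemma ci_self_imp_determined:
  assumes ci: "ci X f g f" and s: "s \<in> set_pmf X" and t: "t \<in> set_pmf X" and eq: "g s = g t"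
  shows "f s = f t"
proof (rule ccontr)
  assume ne: "f s \<noteq> f t"
  let ?P = "measure_pmf.prob X"
  have pos: "?P {s'. f s' = f s \<and> g s' = g s} > 0"
    by (rule measure_pmf_posI[OF s]) simp
  moreover have "?P {s'. f s' = f t \<and> g s' = g s} > 0"
    by (rule measure_pmf_posI[OF t]) (simp add: eq)
  moreover have "{s'. f s' = f s \<and> g s' = g s \<and> f s' = f t} = {}" using ne by auto
  then have "?P {s'. f s' = f s \<and> g s' = g s} * ?P {s'. g s' = g s \<and> f s' = f t} = 0"
    using ci[unfolded ci_def, rule_format, of "f s" "g s" "f t"] by (simp only: measure_empty mult_zero_left)
  ultimately show False by (simp add: conj_commute)
qed

lemma ci_determined:
  assumes det: "\<And>s t. s \<in> set_pmf X \<Longrightarrow> t \<in> set_pmf X \<Longrightarrow> g s = g t \<Longrightarrow> f s = f t"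
  shows "ci X f g h"
  unfolding ci_def
proof (intro allI)
  fix a b c
  let ?P = "measure_pmf.prob X"
  show "?P {s. f s = a \<and> g s = b} * ?P {s. g s = b \<and> h s = c} =
    ?P {s. f s = a \<and> g s = b \<and> h s = c} * ?P {s. g s = b}"
  proof (cases "\<exists>t\<in>set_pmf X. g t = b \<and> f t = a")
    case True
    then have fa: "f s = a" if "s \<in> set_pmf X" "g s = b" for s using that det by blast
    have "?P {s. f s = a \<and> g s = b} = ?P {s. g s = b}"
      "?P {s. f s = a \<and> g s = b \<and> h s = c} = ?P {s. g s = b \<and> h s = c}"
      by (rule prob_cong_set_pmf; use fa in auto)+
    then show ?thesis by simp
  next
    case False
    have "?P {s. f s = a \<and> g s = b} = ?P {s. False}"
      "?P {s. f s = a \<and> g s = b \<and> h s = c} = ?P {s. False}"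
      by (rule prob_cong_set_pmf; use False in auto)+
    then show ?thesis by simp
  qed
qed


section \<open>Soundness of the rules for atoms\<close>

lemma vals_append [simp]: "vals s (us @ vs) = vals s us @ vals s vs"
  by (simp add: vals_def)

lemma length_vals [simp]: "length (vals s us) = length us"
  by (simp add: vals_def)

lemma vals_eq_iff: "vals s us = vals t us \<longleftrightarrow> (\<forall>u\<in>set us. the (s u) = the (t u))"
  by (simp add: vals_def)

text \<open>Lists of the wrong length are never values of a tuple, so for them both sides of the
  equation vanish and the length restriction of \<open>cond_indep\<close> costs nothing.\<close>

lemma cond_indep_iff_ci:
  "cond_indep X us vs ws \<longleftrightarrow> ci X (\<lambda>s. vals s us) (\<lambda>s. vals s vs) (\<lambda>s. vals s ws)"
proof
  assume L: "cond_indep X us vs ws"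
  show "ci X (\<lambda>s. vals s us) (\<lambda>s. vals s vs) (\<lambda>s. vals s ws)"
    unfolding ci_def
  proof (intro allI)
    fix as bs cs
    let ?P = "measure_pmf.prob X"
    show "?P {s. vals s us = as \<and> vals s vs = bs} * ?P {s. vals s vs = bs \<and> vals s ws = cs} =
      ?P {s. vals s us = as \<and> vals s vs = bs \<and> vals s ws = cs} * ?P {s. vals s vs = bs}"
    proof (cases "length as = length us \<and> length bs = length vs \<and> length cs = length ws")
      case True
      then show ?thesis
        using L[unfolded cond_indep_def, rule_format, of as bs cs] by (simp add: weight_def)
    next
      case False
      then have "(\<forall>s. vals s us \<noteq> as) \<or> (\<forall>s. vals s vs \<noteq> bs) \<or> (\<forall>s. vals s ws \<noteq> cs)"
        using length_vals by metis
      then show ?thesis by auto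
    qed
  qed
next
  assume "ci X (\<lambda>s. vals s us) (\<lambda>s. vals s vs) (\<lambda>s. vals s ws)"
  then show "cond_indep X us vs ws"
    by (simp add: cond_indep_def ci_def weight_def)
qed

lemma cond_indep_sym: "cond_indep X us vs ws \<Longrightarrow> cond_indep X ws vs us"
  unfolding cond_indep_iff_ci by (rule ci_sym)

lemma cond_indep_refl: "cond_indep X vs vs ws"
  by (simp add: cond_indep_iff_ci ci_refl)

text \<open>The common core of the structural rules (weakening, permutation, fixed parameter,
  decomposition, repetition): only the sets of variables count, and the outer tuples may shrink or
  absorb variables of the condition.\<close>

lemma cond_indep_mono:
  assumes fin: "finite (set_pmf X)" and "cond_indep X us vs ws"
    and us: "set us' \<subseteq> set us \<union> set vs" and vs: "set vs' = set vs"
    and ws: "set ws' \<subseteq> set ws \<union> set vs"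
  shows "cond_indep X us' vs' ws'"
proof -
  have "ci X (\<lambda>s. vals s us) (\<lambda>s. vals s vs) (\<lambda>s. vals s ws)"
    using assms(2) by (simp add: cond_indep_iff_ci)
  then have "ci X (\<lambda>s. vals s us') (\<lambda>s. vals s vs) (\<lambda>s. vals s ws)"
    by (rule ci_map_left[OF fin]) (use us in \<open>auto simp: vals_eq_iff\<close>)
  then have "ci X (\<lambda>s. vals s us') (\<lambda>s. vals s vs) (\<lambda>s. vals s ws')"
    by (rule ci_map_right[OF fin]) (use ws in \<open>auto simp: vals_eq_iff\<close>)
  then have "ci X (\<lambda>s. vals s us') (\<lambda>s. vals s vs') (\<lambda>s. vals s ws')"
    by (rule ci_cong_condition) (use vs in \<open>simp add: vals_eq_iff\<close>)
  then show ?thesis by (simp add: cond_indep_iff_ci)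
qed

lemma cond_indep_weak_union:
  assumes fin: "finite (set_pmf X)" and "cond_indep X us vs (ws @ ts)"
  shows "cond_indep X us (vs @ ts) ws"
proof -
  have "ci X (\<lambda>s. vals s us) (\<lambda>s. vals s vs) (\<lambda>s. vals s (ws @ ts))"
    using assms(2) by (simp only: cond_indep_iff_ci)
  then have "ci X (\<lambda>s. vals s us) (\<lambda>s. vals s vs) (\<lambda>s. (vals s ws, vals s ts))"
    by (rule ci_map_right[OF fin]) simp
  then have "ci X (\<lambda>s. vals s us) (\<lambda>s. (vals s vs, vals s ts)) (\<lambda>s. vals s ws)"
    by (rule ci_weak_union[OF fin])
  then have "ci X (\<lambda>s. vals s us) (\<lambda>s. vals s (vs @ ts)) (\<lambda>s. vals s ws)"
    by (rule ci_cong_condition) simp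
  then show ?thesis by (simp only: cond_indep_iff_ci)
qed

lemma cond_indep_contraction:
  assumes fin: "finite (set_pmf X)"
    and "cond_indep X us vs ws" "cond_indep X us (vs @ ws) ts"
  shows "cond_indep X us vs (ws @ ts)"
proof -
  have "ci X (\<lambda>s. vals s us) (\<lambda>s. vals s (vs @ ws)) (\<lambda>s. vals s ts)"
    using assms(3) by (simp only: cond_indep_iff_ci)
  then have "ci X (\<lambda>s. vals s us) (\<lambda>s. (vals s vs, vals s ws)) (\<lambda>s. vals s ts)"
    by (rule ci_cong_condition) simp
  moreover have "ci X (\<lambda>s. vals s us) (\<lambda>s. vals s vs) (\<lambda>s. vals s ws)"
    using assms(2) by (simp only: cond_indep_iff_ci)
  ultimately have "ci X (\<lambda>s. vals s us) (\<lambda>s. vals s vs) (\<lambda>s. (vals s ws, vals s ts))"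
    by (intro ci_contraction)
  then have "ci X (\<lambda>s. vals s us) (\<lambda>s. vals s vs) (\<lambda>s. vals s (ws @ ts))"
    by (rule ci_map_right[OF fin]) simp
  then show ?thesis by (simp only: cond_indep_iff_ci)
qed

definition determines :: "'a assignment pmf \<Rightarrow> var list \<Rightarrow> var list \<Rightarrow> bool" where
  "determines X xs ys \<longleftrightarrow>
     (\<forall>s\<in>set_pmf X. \<forall>t\<in>set_pmf X. vals s xs = vals t xs \<longrightarrow> vals s ys = vals t ys)"

lemma cond_indep_self_iff: "cond_indep X ys xs ys \<longleftrightarrow> determines X xs ys"
  unfolding cond_indep_iff_ci determines_def
  using ci_self_imp_determined[of X "\<lambda>s. vals s ys" "\<lambda>s. vals s xs"]
    ci_determined[of X "\<lambda>s. vals s xs" "\<lambda>s. vals s ys" "\<lambda>s. vals s ys"] by blast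

lemma determines_imp_cond_indep: "determines X xs ys \<Longrightarrow> cond_indep X ys xs zs"
  unfolding cond_indep_iff_ci determines_def
  by (rule ci_determined) blast

section \<open>Axioms and rules for atoms, reduced to weak union, contraction and functional
  dependence\<close>

lemma sat_atom_axiom:
  assumes "finite (set_pmf X)" "atom_axiom \<phi>"
  shows "sat \<phi> \<AA> V X"
  using assms(2)
proof cases
  case (empty_independence xs zs)
  have "cond_indep X zs zs xs" by (rule cond_indep_refl)
  then have "cond_indep X xs zs zs" by (rule cond_indep_sym)
  then have "cond_indep X xs zs []"
    by (rule cond_indep_mono[OF assms(1)]) auto
  then show ?thesis using empty_independence by simp
next
  case (dep_reflexivity xs ys)
  then show ?thesis by (simp add: cond_indep_self_iff determines_def)
qed (simp add: cond_indep_refl)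

lemma sat_atom_rule:
  assumes fin: "finite (set_pmf X)" and "atom_rule \<phi> \<psi>" "sat \<phi> \<AA> V X"
  shows "sat \<psi> \<AA> V X"
proof -
  have mono: "sat (us' \<perp>\<^bsub>vs'\<^esub> ws') \<AA> V X" if "sat (us \<perp>\<^bsub>vs\<^esub> ws) \<AA> V X"
    "set us' \<subseteq> set us \<union> set vs" "set vs' = set vs" "set ws' \<subseteq> set ws \<union> set vs"
    for us vs ws us' vs' ws'
    using that cond_indep_mono[OF fin, of us vs ws us' vs' ws'] by simp
  from assms(2) show ?thesis
  proof cases
    case (constancy ys xs zs)
    show ?thesis
      using assms(3) unfolding constancy sat.simps cond_indep_self_iff
      by (rule determines_imp_cond_indep)
  next
    case (symmetry zs xs ys)
    show ?thesis
      using assms(3) unfolding symmetry sat.simps by (rule cond_indep_sym)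
  next
    case (weakening ys y' xs zs z')
    show ?thesis
      unfolding weakening(2) by (rule mono[OF assms(3)[unfolded weakening(1)]]) auto
  next
    case (permutation ys' ys xs' xs zs' zs)
    then have "set ys' = set ys" "set xs' = set xs" "set zs' = set zs"
      by (auto dest: mset_eq_setD)
    then show ?thesis
      unfolding permutation(2) by (intro mono[OF assms(3)[unfolded permutation(1)]]) auto
  next
    case (fixed_parameter zs xs ys)
    have "sat (ys \<perp>\<^bsub>xs\<^esub> zs) \<AA> V X"
      using assms(3) unfolding fixed_parameter(1) sat.simps by (rule cond_indep_sym)
    then show ?thesis
      unfolding fixed_parameter(2) by (rule mono) auto
  next
    case (first_transitivity xs zs ys us)
    \<comment> \<open>With sides swapped, both premises have \<open>ys\<close> on the left, and the
      rule becomes contraction followed by dropping \<open>xs\<close>.\<close>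
    then have "cond_indep X ys zs xs" "cond_indep X ys (zs @ xs) us"
      using assms(3) cond_indep_sym[of X xs zs ys] cond_indep_sym[of X us "zs @ xs" ys]
      by simp_all
    then have "cond_indep X ys zs (xs @ us)" by (rule cond_indep_contraction[OF fin])
    from cond_indep_sym[OF this] have "cond_indep X us zs ys"
      by (rule cond_indep_mono[OF fin]) auto
    then show ?thesis using first_transitivity by simp
  next
    case (second_transitivity ys zs xs us)
    \<comment> \<open>Since \<open>zs\<close> determines \<open>ys\<close>, the latter is
      independent of \<open>us\<close> over \<open>zs\<close>. Weak union moves \<open>zs\<close>
      into the condition of the second premise; contraction over \<open>zs\<close> then joins
      \<open>ys\<close> and \<open>xs\<close>, and \<open>ys\<close> is dropped.\<close>
    then have d: "cond_indep X ys zs us" and i: "cond_indep X us ys (zs @ xs)"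
      using assms(3) determines_imp_cond_indep[of X zs ys us] cond_indep_sym[of X "zs @ xs" ys us]
      by (simp_all add: cond_indep_self_iff)
    from i have "cond_indep X us ys (xs @ zs)" by (rule cond_indep_mono[OF fin]) auto
    from cond_indep_weak_union[OF fin this] have "cond_indep X us (zs @ ys) xs"
      by (rule cond_indep_mono[OF fin]) auto
    from cond_indep_contraction[OF fin cond_indep_sym[OF d] this]
    have "cond_indep X (ys @ xs) zs us" by (rule cond_indep_sym)
    then have "cond_indep X xs zs us" by (rule cond_indep_mono[OF fin]) auto
    then show ?thesis using second_transitivity by simp
  next
    case (exchange xs zs ys us)
    \<comment> \<open>Weak union moves \<open>ys\<close> from the second premise into the condition,
      which gives the second premise of contraction.\<close>
    then have a: "cond_indep X xs zs ys" and "cond_indep X us zs (xs @ ys)"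
      using assms(3) cond_indep_sym[of X "xs @ ys" zs us] by simp_all
    from cond_indep_weak_union[OF fin this(2)] have "cond_indep X xs (zs @ ys) us"
      by (rule cond_indep_sym)
    from cond_indep_contraction[OF fin a this] show ?thesis using exchange by simp
  next
    case (dep_transitivity xs ys zs)
    show ?thesis
      using assms(3) unfolding dep_transitivity sat.simps cond_indep_self_iff determines_def
      by blast
  next
    case (dep_augmentation xs ys)
    show ?thesis
      using assms(3)
      unfolding dep_augmentation sat.simps cond_indep_self_iff determines_def
      by (metis vals_append)
  next
    case (dep_permutation xs' xs ys' ys)
    then have "set ys' = set ys" "set xs' = set xs"
      by (auto dest: mset_eq_setD)
    then show ?thesis
      unfolding dep_permutation(2) by (intro mono[OF assms(3)[unfolded dep_permutation(1)]]) auto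
  next
    case (decomposition xs zs ys ws)
    show ?thesis
      unfolding decomposition(2) by (rule mono[OF assms(3)[unfolded decomposition(1)]]) auto
  next
    case (weak_union xs zs ys ws)
    then show ?thesis using assms(3) cond_indep_weak_union[OF fin, of xs zs ys ws] by simp
  next
    case (contraction xs zs ys ws)
    then show ?thesis using assms(3) cond_indep_contraction[OF fin, of xs zs ys ws] by simp
  next
    case (repetition xs zs ys)
    show ?thesis
      unfolding repetition(2) by (rule mono[OF assms(3)[unfolded repetition(1)]]) auto
  qed
qed


section \<open>Transfer along renamings, restrictions and changes of irrelevant sorts\<close>

text \<open>A map on all variables, in contrast to the single replacement in \<open>subst\<close>,
  keeps its form under a quantifier: there it is reset to the identity at the bound
  variable.\<close>

primrec rename :: "(var \<Rightarrow> var) \<Rightarrow> 'r fm \<Rightarrow> 'r fm" where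
  "rename \<rho> (Eq u v) = Eq (\<rho> u) (\<rho> v)"
| "rename \<rho> (Neq u v) = Neq (\<rho> u) (\<rho> v)"
| "rename \<rho> (Rel R xs) = Rel R (map \<rho> xs)"
| "rename \<rho> (NRel R xs) = NRel R (map \<rho> xs)"
| "rename \<rho> (us \<perp>\<^bsub>vs\<^esub> ws) = map \<rho> us \<perp>\<^bsub>map \<rho> vs\<^esub> map \<rho> ws"
| "rename \<rho> (Conj \<phi> \<psi>) = Conj (rename \<rho> \<phi>) (rename \<rho> \<psi>)"
| "rename \<rho> (Disj \<phi> \<psi>) = Disj (rename \<rho> \<phi>) (rename \<rho> \<psi>)"
| "rename \<rho> (Exi v \<phi>) = Exi v (rename (\<rho>(v := v)) \<phi>)"
| "rename \<rho> (Uni v \<phi>) = Uni v (rename (\<rho>(v := v)) \<phi>)"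
| "rename \<rho> (NewExi v \<phi>) = NewExi v (rename (\<rho>(v := v)) \<phi>)"
| "rename \<rho> (NewUni v \<phi>) = NewUni v (rename (\<rho>(v := v)) \<phi>)"

text \<open>Like \<open>free_for\<close>, this tests only the free variables of the scope, so a
  quantifier over the new name is harmless where the replaced variable is not free.\<close>

primrec capture_free :: "(var \<Rightarrow> var) \<Rightarrow> 'r fm \<Rightarrow> bool" where
  "capture_free \<rho> (Eq u v) \<longleftrightarrow> True"
| "capture_free \<rho> (Neq u v) \<longleftrightarrow> True"
| "capture_free \<rho> (Rel R xs) \<longleftrightarrow> True"
| "capture_free \<rho> (NRel R xs) \<longleftrightarrow> True"
| "capture_free \<rho> (us \<perp>\<^bsub>vs\<^esub> ws) \<longleftrightarrow> True"
| "capture_free \<rho> (Conj \<phi> \<psi>) \<longleftrightarrow> capture_free \<rho> \<phi> \<and> capture_free \<rho> \<psi>"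
| "capture_free \<rho> (Disj \<phi> \<psi>) \<longleftrightarrow> capture_free \<rho> \<phi> \<and> capture_free \<rho> \<psi>"
| "capture_free \<rho> (Exi v \<phi>) \<longleftrightarrow> (\<forall>u\<in>fv \<phi> - {v}. \<rho> u \<noteq> v) \<and> capture_free (\<rho>(v := v)) \<phi>"
| "capture_free \<rho> (Uni v \<phi>) \<longleftrightarrow> (\<forall>u\<in>fv \<phi> - {v}. \<rho> u \<noteq> v) \<and> capture_free (\<rho>(v := v)) \<phi>"
| "capture_free \<rho> (NewExi v \<phi>) \<longleftrightarrow> (\<forall>u\<in>fv \<phi> - {v}. \<rho> u \<noteq> v) \<and> capture_free (\<rho>(v := v)) \<phi>"
| "capture_free \<rho> (NewUni v \<phi>) \<longleftrightarrow> (\<forall>u\<in>fv \<phi> - {v}. \<rho> u \<noteq> v) \<and> capture_free (\<rho>(v := v)) \<phi>"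

lemma fun_upd_id_update: "(id(x := y))(v := v) = (if v = x then id else id(x := y))"
  by auto

lemma fun_upd_id_same: "id(v := v) = id"
  by auto

lemma rename_id [simp]: "rename id \<phi> = \<phi>"
  by (induction \<phi>) (simp_all only: rename.simps fun_upd_id_same list.map_id, simp_all)

text \<open>Handles the subformulas without a free \<open>x\<close>: there \<open>free_for\<close>
  tolerates quantifiers over \<open>y\<close>, although the map \<open>id(x := y)\<close> itself is
  not the identity.\<close>

lemma capture_free_id_on_fv: "(\<And>u. u \<in> fv \<phi> \<Longrightarrow> \<rho> u = u) \<Longrightarrow> capture_free \<rho> \<phi>"
proof (induction \<phi> arbitrary: \<rho>)
  case (Exi v \<phi>)
  have "capture_free (\<rho>(v := v)) \<phi>" by (rule Exi.IH) (use Exi.prems in auto)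
  then show ?case using Exi.prems by auto
next
  case (Uni v \<phi>)
  have "capture_free (\<rho>(v := v)) \<phi>" by (rule Uni.IH) (use Uni.prems in auto)
  then show ?case using Uni.prems by auto
next
  case (NewExi v \<phi>)
  have "capture_free (\<rho>(v := v)) \<phi>" by (rule NewExi.IH) (use NewExi.prems in auto)
  then show ?case using NewExi.prems by auto
next
  case (NewUni v \<phi>)
  have "capture_free (\<rho>(v := v)) \<phi>" by (rule NewUni.IH) (use NewUni.prems in auto)
  then show ?case using NewUni.prems by auto
qed auto

lemma capture_free_id [simp]: "capture_free id \<phi>"
  by (rule capture_free_id_on_fv) simp

lemma subst_eq_rename: "subst y x \<phi> = rename (id(x := y)) \<phi>"
proof (induction \<phi>)
  case (Exi v \<phi>)
  show ?case
    unfolding subst.simps rename.simps fun_upd_id_update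
    by (cases "v = x") (simp_all only: Exi rename_id refl if_True if_False)
next
  case (Uni v \<phi>)
  show ?case
    unfolding subst.simps rename.simps fun_upd_id_update
    by (cases "v = x") (simp_all only: Uni rename_id refl if_True if_False)
next
  case (NewExi v \<phi>)
  show ?case
    unfolding subst.simps rename.simps fun_upd_id_update
    by (cases "v = x") (simp_all only: NewExi rename_id refl if_True if_False)
next
  case (NewUni v \<phi>)
  show ?case
    unfolding subst.simps rename.simps fun_upd_id_update
    by (cases "v = x") (simp_all only: NewUni rename_id refl if_True if_False)
qed (auto simp: fun_eq_iff)

lemma capture_free_if_free_for: "free_for y x \<phi> \<Longrightarrow> capture_free (id(x := y)) \<phi>"
proof (induction \<phi>)
  have under_quantifier:
    "(\<forall>u\<in>fv \<phi> - {v}. (id(x := y)) u \<noteq> v) \<and> capture_free ((id(x := y))(v := v)) \<phi>"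
    if IH: "free_for y x \<phi> \<Longrightarrow> capture_free (id(x := y)) \<phi>"
      and "x \<notin> fv \<phi> - {v} \<or> v \<noteq> y \<and> free_for y x \<phi>" for v and \<phi> :: "'a fm"
  proof (cases "x \<in> fv \<phi> - {v}")
    case True
    then have "v \<noteq> x" "v \<noteq> y" "free_for y x \<phi>" using that by auto
    moreover from this(3) have "capture_free (id(x := y)) \<phi>" by (rule IH)
    ultimately show ?thesis unfolding fun_upd_id_update by auto
  next
    case False
    have "capture_free ((id(x := y))(v := v)) \<phi>"
      by (rule capture_free_id_on_fv) (use False in auto)
    then show ?thesis using False by auto
  qed
  {
    case (Exi v \<phi>)
    then show ?case
      unfolding free_for.simps capture_free.simps fv.simps by (intro under_quantifier)
  next
    case (Uni v \<phi>)
    then show ?case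
      unfolding free_for.simps capture_free.simps fv.simps by (intro under_quantifier)
  next
    case (NewExi v \<phi>)
    then show ?case
      unfolding free_for.simps capture_free.simps fv.simps by (intro under_quantifier)
  next
    case (NewUni v \<phi>)
    then show ?case
      unfolding free_for.simps capture_free.simps fv.simps by (intro under_quantifier)
  }
qed simp_all

section \<open>Sorts of free variables, finite structures and their assignments\<close>

lemma fv_subset_occ: "fv \<phi> \<subseteq> occ \<phi>"
  by (induction \<phi>) auto

lemma is_fm_fv_sorts: "is_fm \<phi> \<tau> \<Longrightarrow> u \<in> fv \<phi> \<Longrightarrow> vsort u \<in> sorts \<tau>"
  by (induction \<phi> arbitrary: \<tau>) (fastforce simp: add_sort_def)+

lemma finite_fv [simp]: "finite (fv \<phi>)"
  by (induction \<phi>) auto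

text \<open>Soundness is proved over this class because it passes to expansions directly: after a
  new domain is added, relations do not have to be checked against it.\<close>

definition finite_struct :: "'r vocab \<Rightarrow> ('r, 'a) struct \<Rightarrow> bool" where
  "finite_struct \<tau> \<AA> \<longleftrightarrow> (\<forall>n\<in>sorts \<tau>. finite (univ \<AA> n) \<and> univ \<AA> n \<noteq> {})"

lemma finite_struct_expand:
  "finite_struct \<tau> \<AA> \<Longrightarrow> finite B \<Longrightarrow> B \<noteq> {} \<Longrightarrow> finite_struct (add_sort \<tau> n) (expand \<AA> n B)"
  by (simp add: finite_struct_def expand_def add_sort_def)

lemma univ_expand [simp]: "univ (expand \<AA> n B) m = (if m = n then B else univ \<AA> m)"
  by (simp add: expand_def)

lemma interp_expand [simp]: "interp (expand \<AA> n B) = interp \<AA>"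
  by (simp add: expand_def)

lemma sorts_add_sort [simp]: "sorts (add_sort \<tau> n) = insert n (sorts \<tau>)"
  by (simp add: add_sort_def)

lemma assignments_expand:
  "vsort ` V \<subseteq> sorts \<tau> \<Longrightarrow> n \<notin> sorts \<tau> \<Longrightarrow> assignments (expand \<AA> n B) V = assignments \<AA> V"
  by (intro set_eqI) (auto simp: assignments_def)

lemma finite_assignments:
  assumes "finite V" "vsort ` V \<subseteq> sorts \<tau>" "finite_struct \<tau> \<AA>"
  shows "finite (assignments \<AA> V)"
proof (rule finite_subset)
  let ?B = "\<Union>v\<in>V. univ \<AA> (vsort v)"
  show "assignments \<AA> V \<subseteq> {s. dom s = V \<and> ran s \<subseteq> ?B}"
    by (force simp: assignments_def ran_def)
  have "finite ?B" using assms by (auto simp: finite_struct_def)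
  from finite_set_of_finite_maps[OF assms(1) this]
  show "finite {s. dom s = V \<and> ran s \<subseteq> ?B}" .
qed

lemma assignments_supplement:
  assumes "set_pmf X \<subseteq> assignments \<AA> V" "\<forall>s\<in>set_pmf X. set_pmf (F s) \<subseteq> univ \<AA> (vsort v)"
  shows "set_pmf (supplement X F v) \<subseteq> assignments \<AA> (insert v V)"
proof
  fix s assume "s \<in> set_pmf (supplement X F v)"
  then obtain t a where t: "t \<in> set_pmf X" "a \<in> set_pmf (F t)" "s = t(v \<mapsto> a)"
    by (auto simp: supplement_def)
  then have "t \<in> assignments \<AA> V" "a \<in> univ \<AA> (vsort v)" using assms by auto
  then show "s \<in> assignments \<AA> (insert v V)" using t(3) by (auto simp: assignments_def)
qed

section \<open>Couplings, kernels and mixtures\<close>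

lemma rel_pmf_kernel:
  assumes "rel_pmf R X X'"
  obtains K where "bind_pmf X K = X'" "\<And>s s'. s \<in> set_pmf X \<Longrightarrow> s' \<in> set_pmf (K s) \<Longrightarrow> R s s'"
proof -
  from assms obtain J where J: "\<And>s s'. (s, s') \<in> set_pmf J \<Longrightarrow> R s s'"
    "map_pmf fst J = X" "map_pmf snd J = X'"
    by (auto elim: rel_pmf.cases)
  \<comment> \<open>The conditional law of the coupling given its first component. The conditioning
    event is nonempty exactly for \<open>s\<close> in the support of \<open>X\<close>, so statements
    about \<open>C s\<close> are confined to that support.\<close>
  define C where "C s = cond_pmf J {p. s = fst p}" for s
  have ne: "set_pmf J \<inter> {p. s = fst p} \<noteq> {}" if "s \<in> set_pmf X" for s
    using that J(2) by auto
  have "bind_pmf X C = J"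
    unfolding C_def
  proof (rule bind_cond_pmf_cancel)
    fix s p assume "s \<in> set_pmf X" "p \<in> set_pmf J" "s = fst p"
    show "measure_pmf.prob J {p. s = fst p} = measure_pmf.prob X {s. s = fst p}"
      unfolding J(2)[symmetric] \<open>s = fst p\<close> by (simp add: vimage_def eq_commute)
  next
    fix p assume "p \<in> set_pmf J"
    then show "set_pmf X \<inter> {s. s = fst p} \<noteq> {}" using J(2) by force
  qed (rule ne)
  then have "bind_pmf X (\<lambda>s. map_pmf snd (C s)) = X'"
    using J(3) by (simp add: map_bind_pmf[symmetric])
  moreover have "R s s'" if "s \<in> set_pmf X" "s' \<in> set_pmf (map_pmf snd (C s))" for s s'
    using that J(1) ne[OF that(1)] by (auto simp: C_def)
  ultimately show thesis by (rule that)
qed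

lemma rel_pmf_bind_cong:
  assumes "\<And>s. s \<in> set_pmf X \<Longrightarrow> rel_pmf R (f s) (g s)"
  shows "rel_pmf R (bind_pmf X f) (bind_pmf X g)"
  by (rule rel_pmf_bindI[where R = "\<lambda>s t. s = t \<and> s \<in> set_pmf X"])
    (use assms in \<open>auto intro: rel_pmf_reflI\<close>)

text \<open>At \<open>s'\<close> the new choice draws a partner \<open>s\<close> from a kernel
  leading from \<open>X'\<close> to \<open>X\<close> and then chooses as \<open>F\<close> does at
  \<open>s\<close>. Both supplemented teams thus arise from drawing \<open>s'\<close>,
  \<open>s\<close> and the same value \<open>a\<close>.\<close>

lemma rel_pmf_supplement:
  assumes rel: "rel_pmf R X X'" and F: "\<forall>s\<in>set_pmf X. set_pmf (F s) \<subseteq> B"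
    and upd: "\<And>s s' a. R s s' \<Longrightarrow> R' (s(v \<mapsto> a)) (s'(v \<mapsto> a))"
  shows "\<exists>F'. (\<forall>s\<in>set_pmf X'. set_pmf (F' s) \<subseteq> B) \<and>
    rel_pmf R' (supplement X F v) (supplement X' F' v)"
proof -
  have "rel_pmf R\<inverse>\<inverse> X' X" using rel by (simp add: pmf.rel_flip)
  then obtain K where K: "bind_pmf X' K = X"
    "\<And>s s'. s' \<in> set_pmf X' \<Longrightarrow> s \<in> set_pmf (K s') \<Longrightarrow> R s s'"
    by (rule rel_pmf_kernel) simp
  let ?F = "\<lambda>s'. bind_pmf (K s') F"
  have "set_pmf (?F s') \<subseteq> B" if "s' \<in> set_pmf X'" for s'
    using that F unfolding K(1)[symmetric] by fastforce
  moreover have "rel_pmf R' (bind_pmf (bind_pmf X' K) (\<lambda>t. map_pmf (\<lambda>a. t(v \<mapsto> a)) (F t)))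
      (bind_pmf X' (\<lambda>s'. map_pmf (\<lambda>a. s'(v \<mapsto> a)) (?F s')))"
    unfolding bind_assoc_pmf map_bind_pmf
    by (intro rel_pmf_bind_cong) (auto simp: pmf.rel_map intro!: rel_pmf_reflI upd K(2))
  ultimately show ?thesis
    unfolding supplement_def K(1) by (intro exI[of _ ?F]) auto
qed

lemma rel_pmf_duplicate:
  assumes "rel_pmf R X X'" and "\<And>s s' a. R s s' \<Longrightarrow> R' (s(v \<mapsto> a)) (s'(v \<mapsto> a))"
  shows "rel_pmf R' (duplicate X B v) (duplicate X' B v)"
  unfolding duplicate_def supplement_def
  by (rule rel_pmf_bindI[OF assms(1)]) (auto simp: pmf.rel_map intro!: rel_pmf_reflI assms(2))

text \<open>As a two-stage experiment, a mixture is carried through a kernel by associativity of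
  \<open>bind_pmf\<close>.\<close>

lemma is_mixture_iff_bind:
  assumes "r \<in> {0..1}"
  shows "is_mixture r X Y Z \<longleftrightarrow> X = bind_pmf (bernoulli_pmf r) (\<lambda>b. if b then Y else Z)"
  using assms by (auto simp: is_mixture_def pmf_eq_iff pmf_bind)

section \<open>Assignments that agree along a renaming, and the transfer theorem\<close>

definition agrees :: "(var \<Rightarrow> var) \<Rightarrow> var set \<Rightarrow> 'a assignment \<Rightarrow> 'a assignment \<Rightarrow> bool" where
  "agrees \<rho> U s s' \<longleftrightarrow> (\<forall>u\<in>U. s (\<rho> u) = s' u)"

lemma rel_pmf_agrees_mono:
  "rel_pmf (agrees \<rho> U) X X' \<Longrightarrow> U' \<subseteq> U \<Longrightarrow> rel_pmf (agrees \<rho> U') X X'"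
  by (erule pmf.rel_mono_strong) (auto simp: agrees_def)

text \<open>This is where freedom from capture is used: no other variable of \<open>U\<close> is
  renamed to \<open>v\<close>, so overwriting \<open>v\<close> on the renamed side changes nothing
  that \<open>s'\<close> is compared with.\<close>

lemma agrees_update:
  assumes "agrees \<rho> (U - {v}) s s'" "\<forall>u\<in>U - {v}. \<rho> u \<noteq> v"
  shows "agrees (\<rho>(v := v)) U (s(v \<mapsto> a)) (s'(v \<mapsto> a))"
  using assms by (auto simp: agrees_def)

lemma vals_agrees:
  "agrees \<rho> U s s' \<Longrightarrow> set us \<subseteq> U \<Longrightarrow> vals s (map \<rho> us) = vals s' us"
  by (auto simp: agrees_def vals_def)

text \<open>A coupling under which two functions always take the same value forces their laws to
  coincide.\<close>

lemma weight_agrees: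
  assumes "rel_pmf (agrees \<rho> U) X X'" "set us \<subseteq> U"
  shows "weight X (map \<rho> us) as = weight X' us as"
proof -
  have "rel_pmf (=) (map_pmf (\<lambda>s. vals s (map \<rho> us)) X) (map_pmf (\<lambda>s'. vals s' us) X')"
    unfolding pmf.rel_map
    by (rule pmf.rel_mono_strong[OF assms(1)]) (rule vals_agrees[OF _ assms(2)])
  then have "map_pmf (\<lambda>s. vals s (map \<rho> us)) X = map_pmf (\<lambda>s'. vals s' us) X'"
    by (simp add: pmf.rel_eq)
  then have "pmf (map_pmf (\<lambda>s. vals s (map \<rho> us)) X) as = pmf (map_pmf (\<lambda>s'. vals s' us) X') as"
    by simp
  then show ?thesis
    by (simp add: weight_def pmf_map vimage_def)
qed

lemma rel_pmf_setD2:
  assumes "rel_pmf R X X'" "s' \<in> set_pmf X'"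
  obtains s where "s \<in> set_pmf X" "R s s'"
  using rel_pmf_imp_rel_set[OF assms(1)] assms(2) by (auto dest: rel_setD2)

text \<open>The kernel that turns \<open>X\<close> into \<open>X'\<close> is applied to
  \<open>Y\<close> and \<open>Z\<close> separately, and averaging commutes with it. The last
  hypothesis lets the kernel be completed on all of \<open>S\<close>.\<close>

lemma is_mixture_transfer:
  assumes r: "r \<in> {0..1}" and mix: "is_mixture r X Y Z" and rel: "rel_pmf R X X'"
    and X': "set_pmf X' \<subseteq> S'"
    and YZ: "set_pmf Y \<subseteq> S" "set_pmf Z \<subseteq> S" and ex: "\<And>s. s \<in> S \<Longrightarrow> \<exists>s'\<in>S'. R s s'"
  obtains Y' Z' where "is_mixture r X' Y' Z'" "set_pmf Y' \<subseteq> S'" "set_pmf Z' \<subseteq> S'"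
    "rel_pmf R Y Y'" "rel_pmf R Z Z'"
proof -
  obtain K where K: "bind_pmf X K = X'"
    "\<And>s s'. s \<in> set_pmf X \<Longrightarrow> s' \<in> set_pmf (K s) \<Longrightarrow> R s s'"
    using rel by (rule rel_pmf_kernel) blast
  \<comment> \<open>If \<open>r\<close> is \<open>0\<close> or \<open>1\<close>, one of \<open>Y\<close>, \<open>Z\<close> may leave the support of \<open>X\<close>, where \<open>K\<close> is arbitrary.\<close>
  define K' where "K' s = (if s \<in> set_pmf X then K s else return_pmf (SOME s'. s' \<in> S' \<and> R s s'))" for s
  have K': "s' \<in> S' \<and> R s s'" if s: "s \<in> S" and s': "s' \<in> set_pmf (K' s)" for s s'
  proof (cases "s \<in> set_pmf X")
    case True
    then have "s' \<in> set_pmf (K s)" using s' by (simp add: K'_def)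
    moreover from this True have "s' \<in> set_pmf X'" unfolding K(1)[symmetric] by auto
    ultimately show ?thesis using True K(2) X' by blast
  next
    case False
    then have "s' = (SOME s'. s' \<in> S' \<and> R s s')" using s' by (simp add: K'_def)
    moreover have "\<exists>s'. s' \<in> S' \<and> R s s'" using ex[OF s] by blast
    ultimately show ?thesis by (metis (mono_tags, lifting) someI_ex)
  qed
  have rel': "rel_pmf R T (bind_pmf T K')" if "set_pmf T \<subseteq> S" for T
  proof -
    have "rel_pmf R (bind_pmf T return_pmf) (bind_pmf T K')"
      by (rule rel_pmf_bind_cong) (use that K' in \<open>auto simp: rel_pmf_return_pmf1\<close>)
    then show ?thesis by (simp add: bind_return_pmf')
  qed
  have "X' = bind_pmf X K'"
    unfolding K(1)[symmetric] by (rule bind_pmf_cong) (simp_all add: K'_def)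
  also have "\<dots> = bind_pmf (bernoulli_pmf r) (\<lambda>b. if b then bind_pmf Y K' else bind_pmf Z K')"
    using mix unfolding is_mixture_iff_bind[OF r]
    by (auto simp: bind_assoc_pmf intro!: bind_pmf_cong)
  finally have "is_mixture r X' (bind_pmf Y K') (bind_pmf Z K')"
    unfolding is_mixture_iff_bind[OF r] .
  moreover have "set_pmf (bind_pmf T K') \<subseteq> S'" if "set_pmf T \<subseteq> S" for T
    using that K' by fastforce
  ultimately show thesis using rel' YZ by (intro that)
qed

text \<open>Supplies the partners demanded by \<open>is_mixture_transfer\<close> and, with the
  identity renaming, the extension of a team to further variables.\<close>

lemma agreeing_assignment:
  assumes "s \<in> assignments \<AA> V" "finite_struct \<tau> \<AA>'" "vsort ` V' \<subseteq> sorts \<tau>" "U \<subseteq> V'" "\<rho> ` U \<subseteq> V"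
    and "\<forall>u\<in>U. univ \<AA> (vsort (\<rho> u)) = univ \<AA>' (vsort u)"
  shows "\<exists>s'\<in>assignments \<AA>' V'. agrees \<rho> U s s'"
proof -
  \<comment> \<open>Variables outside \<open>U\<close> get an arbitrary element of their domain,
    which is nonempty because their sorts belong to \<open>\<tau>\<close>.\<close>
  define s' where "s' u = (if u \<in> U then s (\<rho> u)
    else if u \<in> V' then Some (SOME a. a \<in> univ \<AA>' (vsort u)) else None)" for u
  have dom: "\<rho> u \<in> dom s \<and> the (s (\<rho> u)) \<in> univ \<AA>' (vsort u)" if "u \<in> U" for u
    using assms(1,5,6) that by (force simp: assignments_def)
  have some: "(SOME a. a \<in> univ \<AA>' (vsort u)) \<in> univ \<AA>' (vsort u)" if "u \<in> V'" for u
    using assms(2,3) that by (auto simp: finite_struct_def some_in_eq)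
  have "dom s' = V'"
    using dom assms(4) by (auto simp: s'_def dom_def split: if_splits)
  moreover have "the (s' u) \<in> univ \<AA>' (vsort u)" if "u \<in> V'" for u
    using dom[of u] some[OF that] that by (simp add: s'_def)
  ultimately have "s' \<in> assignments \<AA>' V'" by (simp add: assignments_def)
  moreover have "agrees \<rho> U s s'" by (simp add: agrees_def s'_def)
  ultimately show ?thesis by blast
qed

text \<open>Domains are compared on \<open>occ\<close>, since bound variables range over them too;
  the teams are coupled only on the free variables, which is what survives the removal of a
  quantifier.\<close>

lemma sat_transfer:
  assumes "is_fm \<phi> \<tau>" "capture_free \<rho> \<phi>" "\<forall>u. vsort (\<rho> u) = vsort u"
    and "finite_struct \<tau> \<AA>'" "interp \<AA> = interp \<AA>'"
    and "\<forall>u\<in>occ \<phi>. univ \<AA> (vsort u) = univ \<AA>' (vsort u)"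
    and "vsort ` V' \<subseteq> sorts \<tau>" "set_pmf X' \<subseteq> assignments \<AA>' V'"
    and "fv \<phi> \<subseteq> V'" "\<rho> ` fv \<phi> \<subseteq> V"
    and "rel_pmf (agrees \<rho> (fv \<phi>)) X X'" "sat (rename \<rho> \<phi>) \<AA> V X"
  shows "sat \<phi> \<AA>' V' X'"
  using assms
proof (induction \<phi> arbitrary: \<tau> \<rho> \<AA> \<AA>' V V' X X')
  case (Eq u v)
  show ?case
    unfolding sat.simps
  proof
    fix s' assume "s' \<in> set_pmf X'"
    with Eq.prems(11) obtain s where "s \<in> set_pmf X" "agrees \<rho> {u, v} s s'"
      by (auto elim: rel_pmf_setD2)
    then show "the (s' u) = the (s' v)"
      using Eq.prems(12) by (fastforce simp: agrees_def)
  qed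
next
  case (Neq u v)
  show ?case
    unfolding sat.simps
  proof
    fix s' assume "s' \<in> set_pmf X'"
    with Neq.prems(11) obtain s where "s \<in> set_pmf X" "agrees \<rho> {u, v} s s'"
      by (auto elim: rel_pmf_setD2)
    then show "the (s' u) \<noteq> the (s' v)"
      using Neq.prems(12) by (fastforce simp: agrees_def)
  qed
next
  case (Rel R xs)
  show ?case
    unfolding sat.simps
  proof
    fix s' assume "s' \<in> set_pmf X'"
    with Rel.prems(11) obtain s where s: "s \<in> set_pmf X" "agrees \<rho> (set xs) s s'"
      by (auto elim: rel_pmf_setD2)
    then have "vals s' xs = vals s (map \<rho> xs)" using vals_agrees by fastforce
    then show "vals s' xs \<in> interp \<AA>' R"
      using s(1) Rel.prems(5,12) by simp
  qed
next
  case (NRel R xs)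
  show ?case
    unfolding sat.simps
  proof
    fix s' assume "s' \<in> set_pmf X'"
    with NRel.prems(11) obtain s where s: "s \<in> set_pmf X" "agrees \<rho> (set xs) s s'"
      by (auto elim: rel_pmf_setD2)
    then have "vals s' xs = vals s (map \<rho> xs)" using vals_agrees by fastforce
    then show "vals s' xs \<notin> interp \<AA>' R"
      using s(1) NRel.prems(5,12) by simp
  qed
next
  case (Indep us vs ws)
  have "weight X (map \<rho> ts) as = weight X' ts as" if "set ts \<subseteq> set us \<union> set vs \<union> set ws" for ts as
    using Indep.prems(11) that by (intro weight_agrees) auto
  from this[of "us @ vs"] this[of "vs @ ws"] this[of "us @ vs @ ws"] this[of vs]
  show ?case
    using Indep.prems(12) by (simp add: cond_indep_def le_supI1 le_supI2)
next
  case (Conj \<phi> \<psi>)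
  have "sat \<phi> \<AA>' V' X'"
    by (rule Conj.IH(1)[of \<tau> \<rho> \<AA>' \<AA> V' X' V X])
      (use Conj.prems in \<open>auto intro: rel_pmf_agrees_mono\<close>)
  moreover have "sat \<psi> \<AA>' V' X'"
    by (rule Conj.IH(2)[of \<tau> \<rho> \<AA>' \<AA> V' X' V X])
      (use Conj.prems in \<open>auto intro: rel_pmf_agrees_mono\<close>)
  ultimately show ?case by simp
next
  case (Disj \<phi> \<psi>)
  let ?R = "agrees \<rho> (fv \<phi> \<union> fv \<psi>)"
  from Disj.prems(12) obtain Y Z r where r: "r \<in> {0..1}"
    and YZ: "set_pmf Y \<subseteq> assignments \<AA> V" "set_pmf Z \<subseteq> assignments \<AA> V"
    and mix: "is_mixture r X Y Z"
    and sat: "sat (rename \<rho> \<phi>) \<AA> V Y" "sat (rename \<rho> \<psi>) \<AA> V Z"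
    by auto
  have rel: "rel_pmf ?R X X'" using Disj.prems(11) by simp
  have eq: "\<forall>u\<in>fv \<phi> \<union> fv \<psi>. univ \<AA> (vsort (\<rho> u)) = univ \<AA>' (vsort u)"
    using Disj.prems(3,6) fv_subset_occ[of \<phi>] fv_subset_occ[of \<psi>] by auto
  have "\<exists>s'\<in>assignments \<AA>' V'. ?R s s'" if "s \<in> assignments \<AA> V" for s
    using that Disj.prems(4,7) _ _ eq by (rule agreeing_assignment) (use Disj.prems(9,10) in auto)
  then obtain Y' Z' where Y'Z': "is_mixture r X' Y' Z'"
    "set_pmf Y' \<subseteq> assignments \<AA>' V'" "set_pmf Z' \<subseteq> assignments \<AA>' V'"
    "rel_pmf ?R Y Y'" "rel_pmf ?R Z Z'"
    using is_mixture_transfer[OF r mix rel Disj.prems(8) YZ] by blast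
  have "sat \<phi> \<AA>' V' Y'"
    by (rule Disj.IH(1)[of \<tau> \<rho> \<AA>' \<AA> V' Y' V Y])
      (use Disj.prems Y'Z' sat in \<open>auto intro: rel_pmf_agrees_mono\<close>)
  moreover have "sat \<psi> \<AA>' V' Z'"
    by (rule Disj.IH(2)[of \<tau> \<rho> \<AA>' \<AA> V' Z' V Z])
      (use Disj.prems Y'Z' sat in \<open>auto intro: rel_pmf_agrees_mono\<close>)
  ultimately show ?case using r Y'Z'(1,2,3) unfolding sat.simps by blast
next
  case (Exi v \<phi>)
  from Exi.prems(12) obtain F where F: "\<forall>s\<in>set_pmf X. set_pmf (F s) \<subseteq> univ \<AA> (vsort v)"
    and sat: "sat (rename (\<rho>(v := v)) \<phi>) \<AA> (insert v V) (supplement X F v)"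
    by auto
  have "\<exists>F'. (\<forall>s\<in>set_pmf X'. set_pmf (F' s) \<subseteq> univ \<AA> (vsort v)) \<and>
      rel_pmf (agrees (\<rho>(v := v)) (fv \<phi>)) (supplement X F v) (supplement X' F' v)"
    by (rule rel_pmf_supplement[OF Exi.prems(11) F])
      (use Exi.prems(2) in \<open>auto intro: agrees_update\<close>)
  then obtain F' where F': "\<forall>s\<in>set_pmf X'. set_pmf (F' s) \<subseteq> univ \<AA>' (vsort v)"
    and rel: "rel_pmf (agrees (\<rho>(v := v)) (fv \<phi>)) (supplement X F v) (supplement X' F' v)"
    using Exi.prems(6) by auto
  have cf: "capture_free (\<rho>(v := v)) \<phi>" using Exi.prems(2) by simp
  have "sat \<phi> \<AA>' (insert v V') (supplement X' F' v)"
    using _ cf _ Exi.prems(4,5) _ _ assignments_supplement[OF Exi.prems(8) F'] _ _ rel sat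
    by (rule Exi.IH[of \<tau> "\<rho>(v := v)"]) (use Exi.prems(1,3,5-7,9,10) in auto)
  then show ?case using F' by auto
next
  case (Uni v \<phi>)
  have "set_pmf (pmf_of_set (univ \<AA>' (vsort v))) = univ \<AA>' (vsort v)"
    using Uni.prems(1,4) by (auto simp: finite_struct_def)
  then have X': "set_pmf (duplicate X' (univ \<AA>' (vsort v)) v) \<subseteq> assignments \<AA>' (insert v V')"
    unfolding duplicate_def by (intro assignments_supplement[OF Uni.prems(8)]) simp
  have rel: "rel_pmf (agrees (\<rho>(v := v)) (fv \<phi>))
      (duplicate X (univ \<AA>' (vsort v)) v) (duplicate X' (univ \<AA>' (vsort v)) v)"
    by (rule rel_pmf_duplicate[OF Uni.prems(11)])
      (use Uni.prems(2) in \<open>auto intro: agrees_update\<close>)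
  have sat: "sat (rename (\<rho>(v := v)) \<phi>) \<AA> (insert v V) (duplicate X (univ \<AA>' (vsort v)) v)"
    using Uni.prems(6,12) by simp
  have cf: "capture_free (\<rho>(v := v)) \<phi>" using Uni.prems(2) by simp
  have "sat \<phi> \<AA>' (insert v V') (duplicate X' (univ \<AA>' (vsort v)) v)"
    using _ cf _ Uni.prems(4,5) _ _ X' _ _ rel sat
    by (rule Uni.IH[of \<tau> "\<rho>(v := v)"]) (use Uni.prems(1,3,5-7,9,10) in auto)
  then show ?case by simp
next
  case (NewExi v \<phi>)
  let ?E = "\<lambda>\<AA> B. expand \<AA> (vsort v) B"
  from NewExi.prems(12) obtain B F where B: "finite B" "B \<noteq> {}"
    and F: "\<forall>s\<in>set_pmf X. set_pmf (F s) \<subseteq> B"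
    and sat: "sat (rename (\<rho>(v := v)) \<phi>) (?E \<AA> B) (insert v V) (supplement X F v)"
    by auto
  have "\<exists>F'. (\<forall>s\<in>set_pmf X'. set_pmf (F' s) \<subseteq> B) \<and>
      rel_pmf (agrees (\<rho>(v := v)) (fv \<phi>)) (supplement X F v) (supplement X' F' v)"
    by (rule rel_pmf_supplement[OF NewExi.prems(11) F])
      (use NewExi.prems(2) in \<open>auto intro: agrees_update\<close>)
  then obtain F' where F': "\<forall>s\<in>set_pmf X'. set_pmf (F' s) \<subseteq> B"
    and rel: "rel_pmf (agrees (\<rho>(v := v)) (fv \<phi>)) (supplement X F v) (supplement X' F' v)"
    by auto
  \<comment> \<open>The same \<open>B\<close> interprets the new sort on both sides. No variable of
    \<open>V'\<close> has this sort, so \<open>X'\<close> stays a team of the expansion.\<close>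
  have fs: "finite_struct (add_sort \<tau> (vsort v)) (?E \<AA>' B)"
    using NewExi.prems(4) B by (rule finite_struct_expand)
  have "vsort v \<notin> sorts \<tau>" using NewExi.prems(1) by simp
  then have X': "set_pmf X' \<subseteq> assignments (?E \<AA>' B) V'"
    using NewExi.prems(7,8) by (simp add: assignments_expand)
  have X'F': "set_pmf (supplement X' F' v) \<subseteq> assignments (?E \<AA>' B) (insert v V')"
    by (rule assignments_supplement[OF X']) (use F' in simp)
  have cf: "capture_free (\<rho>(v := v)) \<phi>" using NewExi.prems(2) by simp
  have "sat \<phi> (?E \<AA>' B) (insert v V') (supplement X' F' v)"
    using _ cf _ fs _ _ _ X'F' _ _ rel sat
    by (rule NewExi.IH[of "add_sort \<tau> (vsort v)" "\<rho>(v := v)"]) (use NewExi.prems(1,3,5-7,9,10) in auto)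
  then show ?case using B F' by auto
next
  case (NewUni v \<phi>)
  let ?E = "\<lambda>\<AA> B. expand \<AA> (vsort v) B"
  have "sat \<phi> (?E \<AA>' B) (insert v V') (duplicate X' B v)" if B: "finite B" "B \<noteq> {}" for B
  proof -
    have fs: "finite_struct (add_sort \<tau> (vsort v)) (?E \<AA>' B)"
      using NewUni.prems(4) B by (rule finite_struct_expand)
    have "vsort v \<notin> sorts \<tau>" using NewUni.prems(1) by simp
    then have X': "set_pmf X' \<subseteq> assignments (?E \<AA>' B) V'"
      using NewUni.prems(7,8) by (simp add: assignments_expand)
    have X'B: "set_pmf (duplicate X' B v) \<subseteq> assignments (?E \<AA>' B) (insert v V')"
      unfolding duplicate_def by (rule assignments_supplement[OF X']) (use B in simp)
    have rel: "rel_pmf (agrees (\<rho>(v := v)) (fv \<phi>)) (duplicate X B v) (duplicate X' B v)"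
      by (rule rel_pmf_duplicate[OF NewUni.prems(11)])
        (use NewUni.prems(2) in \<open>auto intro: agrees_update\<close>)
    have sat: "sat (rename (\<rho>(v := v)) \<phi>) (?E \<AA> B) (insert v V) (duplicate X B v)"
      using NewUni.prems(12) B by simp
    have cf: "capture_free (\<rho>(v := v)) \<phi>" using NewUni.prems(2) by simp
    show ?thesis
      using _ cf _ fs _ _ _ X'B _ _ rel sat
      by (rule NewUni.IH[of "add_sort \<tau> (vsort v)" "\<rho>(v := v)"]) (use NewUni.prems(1,3,5-7,9,10) in auto)
  qed
  then show ?case by simp
qed

text \<open>For the identity renaming, the existence of the coupling says precisely that both teams
  have the same marginal on \<open>fv \<phi>\<close>.\<close>

lemma sat_local:
  assumes "is_fm \<phi> \<tau>" "finite_struct \<tau> \<AA>" "vsort ` V' \<subseteq> sorts \<tau>"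
    and "set_pmf X' \<subseteq> assignments \<AA> V'" "fv \<phi> \<subseteq> V'" "fv \<phi> \<subseteq> V"
    and "rel_pmf (agrees id (fv \<phi>)) X X'" "sat \<phi> \<AA> V X"
  shows "sat \<phi> \<AA> V' X'"
  by (rule sat_transfer[of \<phi> \<tau> id \<AA> \<AA> V' X' V X]) (use assms in simp_all)

section \<open>Teams under supplementing, expansion and substitution\<close>

lemma rel_pmf_agrees_sym: "rel_pmf (agrees id U) X X' \<Longrightarrow> rel_pmf (agrees id U) X' X"
  unfolding pmf.rel_flip[symmetric, of "agrees id U" X]
  by (erule pmf.rel_mono_strong) (simp add: agrees_def)

lemma rel_pmf_agrees_map:
  "(\<And>s. s \<in> set_pmf X \<Longrightarrow> agrees \<rho> U s (f s)) \<Longrightarrow> rel_pmf (agrees \<rho> U) X (map_pmf f X)"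
  by (simp add: pmf.rel_map rel_pmf_reflI)

lemma rel_pmf_agrees_supplement:
  assumes "v \<notin> U"
  shows "rel_pmf (agrees id U) X (supplement X F v)"
proof -
  have "rel_pmf (agrees id U) (bind_pmf X return_pmf) (supplement X F v)"
    unfolding supplement_def
    by (rule rel_pmf_bind_cong) (use assms in \<open>auto simp: rel_pmf_return_pmf1 agrees_def\<close>)
  then show ?thesis by (simp add: bind_return_pmf')
qed

lemma is_team_supplement:
  assumes "is_team \<tau> \<AA> V X" "vsort v \<in> sorts \<tau>"
    "\<forall>s\<in>set_pmf X. set_pmf (F s) \<subseteq> univ \<AA> (vsort v)"
  shows "is_team \<tau> \<AA> (insert v V) (supplement X F v)"
  using assms assignments_supplement[of X \<AA> V F v] by (simp add: is_team_def)

lemma is_team_expand: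
  assumes "is_team \<tau> \<AA> V X" "n \<notin> sorts \<tau>"
  shows "is_team (add_sort \<tau> n) (expand \<AA> n B) V X"
  using assms assignments_expand[of V \<tau> n \<AA> B] by (auto simp: is_team_def)

lemma finite_team:
  "is_team \<tau> \<AA> V X \<Longrightarrow> finite_struct \<tau> \<AA> \<Longrightarrow> finite (set_pmf X)"
  using finite_assignments[of V \<tau> \<AA>] by (auto simp: is_team_def intro: finite_subset)

text \<open>Only the domain of sort \<open>n\<close> changes, and no variable of
  \<open>\<phi>\<close>, free or bound, ranges over it.\<close>

lemma sat_expand:
  assumes "is_fm \<phi> \<tau>" "finite_struct \<tau> \<AA>" "is_team \<tau> \<AA> V X" "fv \<phi> \<subseteq> V"
    and n: "n \<notin> sorts \<tau>" "\<forall>u\<in>occ \<phi>. vsort u \<noteq> n" and "sat \<phi> \<AA> V X"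
  shows "sat \<phi> (expand \<AA> n B) V X"
proof (rule sat_transfer[of \<phi> \<tau> id _ \<AA> V X V X])
  show "finite_struct \<tau> (expand \<AA> n B)"
    using assms(2) n(1) by (auto simp: finite_struct_def)
  show "set_pmf X \<subseteq> assignments (expand \<AA> n B) V"
    using assms(3) n(1) assignments_expand[of V \<tau> n \<AA> B] by (simp add: is_team_def)
  show "rel_pmf (agrees id (fv \<phi>)) X X"
    by (rule rel_pmf_reflI) (simp add: agrees_def)
qed (use assms in \<open>simp_all add: is_team_def\<close>)

text \<open>The witness copies \<open>y\<close>: it is the point mass at the value of
  \<open>y\<close>. The supplemented team is then the image of \<open>X\<close> under a map that
  sends each \<open>s\<close> to an assignment agreeing with it along the renaming of
  \<open>x\<close> to \<open>y\<close>.\<close>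

lemma sat_exi_of_subst:
  assumes "is_fm (Exi x \<phi>) \<tau>" "finite_struct \<tau> \<AA>" and team: "is_team \<tau> \<AA> V X"
    and y: "vsort y = vsort x" "y \<in> V" "free_for y x \<phi>" and "fv (Exi x \<phi>) \<subseteq> V"
    and sat: "sat (subst y x \<phi>) \<AA> V X"
  shows "sat (Exi x \<phi>) \<AA> V X"
proof -
  let ?F = "\<lambda>s. return_pmf (the (s y))"
  have F: "\<forall>s\<in>set_pmf X. set_pmf (?F s) \<subseteq> univ \<AA> (vsort x)"
  proof
    fix s assume "s \<in> set_pmf X"
    then have "s \<in> assignments \<AA> V" using team by (auto simp: is_team_def)
    then have "the (s y) \<in> univ \<AA> (vsort y)" using y(2) by (simp add: assignments_def)
    then show "set_pmf (?F s) \<subseteq> univ \<AA> (vsort x)" using y(1) by simp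
  qed
  have suppl: "supplement X ?F x = map_pmf (\<lambda>s. s(x \<mapsto> the (s y))) X"
    by (simp add: supplement_def map_pmf_def bind_return_pmf)
  have "sat \<phi> \<AA> (insert x V) (supplement X ?F x)"
  proof (rule sat_transfer[of \<phi> \<tau> "id(x := y)" \<AA> \<AA> "insert x V" _ V X])
    show "capture_free (id(x := y)) \<phi>" using y(3) by (rule capture_free_if_free_for)
    show "rel_pmf (agrees (id(x := y)) (fv \<phi>)) X (supplement X ?F x)"
      unfolding suppl
    proof (rule rel_pmf_agrees_map)
      fix s assume "s \<in> set_pmf X"
      then have "y \<in> dom s" using team y(2) by (auto simp: is_team_def assignments_def)
      then show "agrees (id(x := y)) (fv \<phi>) s (s(x \<mapsto> the (s y)))"
        by (auto simp: agrees_def)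
    qed
    show "set_pmf (supplement X ?F x) \<subseteq> assignments \<AA> (insert x V)"
      using team F by (intro assignments_supplement) (auto simp: is_team_def)
    show "sat (rename (id(x := y)) \<phi>) \<AA> V X"
      using sat unfolding subst_eq_rename .
  qed (use assms(1,2,4,5,7) team in \<open>auto simp: is_team_def\<close>)
  then show ?thesis using F unfolding sat.simps by (intro exI[of _ ?F]) simp
qed


section \<open>Downward closure of dependence logic\<close>

text \<open>\<open>X'\<close> is split by conditioning on the support of \<open>Y\<close> and on its
  complement, where the support of \<open>X'\<close> lies within that of \<open>Z\<close>. If one of
  the two parts is null, conditioning on it is impossible; the weight is then 1 or 0, and the old
  \<open>Z\<close> or \<open>Y\<close> fills the empty place.\<close>

lemma is_mixture_subteam:
  assumes r: "r \<in> {0..1}" and mix: "is_mixture r X Y Z" and sub: "set_pmf X' \<subseteq> set_pmf X"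
  obtains r' Y' Z' where "r' \<in> {0..1}" "is_mixture r' X' Y' Z'"
    "set_pmf Y' \<subseteq> set_pmf Y" "set_pmf Z' \<subseteq> set_pmf Z"
proof -
  let ?A = "set_pmf Y"
  have YZ: "set_pmf X' \<subseteq> ?A \<union> set_pmf Z"
  proof
    fix s assume "s \<in> set_pmf X'"
    then have "pmf X s \<noteq> 0" using sub by (auto simp: set_pmf_iff)
    then have "pmf Y s \<noteq> 0 \<or> pmf Z s \<noteq> 0" using mix by (auto simp: is_mixture_def)
    then show "s \<in> ?A \<union> set_pmf Z" by (auto simp: set_pmf_iff)
  qed
  consider "set_pmf X' \<subseteq> ?A" | "set_pmf X' \<subseteq> - ?A"
    | "set_pmf X' \<inter> ?A \<noteq> {}" "set_pmf X' \<inter> - ?A \<noteq> {}" by blast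
  then show thesis
  proof cases
    case 1
    show thesis by (rule that[of 1 X' Z]) (use 1 in \<open>auto simp: is_mixture_def\<close>)
  next
    case 2
    show thesis by (rule that[of 0 Y X']) (use 2 YZ in \<open>auto simp: is_mixture_def\<close>)
  next
    case 3
    let ?p = "measure_pmf.prob X' ?A"
    have p: "measure_pmf.prob X' (- ?A) = 1 - ?p"
      using measure_pmf.prob_compl[of ?A X'] by (simp add: Compl_eq_Diff_UNIV)
    have "?p \<noteq> 0" "measure_pmf.prob X' (- ?A) \<noteq> 0"
      using 3 by (auto simp: measure_pmf_zero_iff)
    then have "is_mixture ?p X' (cond_pmf X' ?A) (cond_pmf X' (- ?A))"
      using 3 p by (auto simp: is_mixture_def pmf_cond)
    then show thesis
      by (rule that[rotated]) (use 3 YZ in \<open>auto simp: set_cond_pmf\<close>)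
  qed
qed

text \<open>In this fragment atoms constrain only single support points or pairs of them, and
  quantifiers keep their old choices because supplementing is monotone in the support. General
  independence atoms compare probabilities, hence the restriction.\<close>

lemma sat_subteam:
  assumes "dependence_logic \<phi>" "set_pmf X' \<subseteq> set_pmf X" "sat \<phi> \<AA> V X"
  shows "sat \<phi> \<AA> V X'"
  using assms
proof (induction \<phi> arbitrary: \<AA> V X X')
  have suppl: "set_pmf (supplement X' F v) \<subseteq> set_pmf (supplement X F v)"
    if "set_pmf X' \<subseteq> set_pmf X" for X X' :: "'b assignment pmf" and F v
    using that by (auto simp: supplement_def)
  {
    case (Indep us vs ws)
    then show ?case by (auto simp: cond_indep_self_iff determines_def)
  next
    case (Conj \<phi> \<psi>)
    then show ?case by (metis dependence_logic.simps(6) sat.simps(6))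
  next
    case (Disj \<phi> \<psi>)
    from Disj.prems(3) obtain Y Z r where r: "r \<in> {0..1}" "is_mixture r X Y Z"
      and Y: "set_pmf Y \<subseteq> assignments \<AA> V" "sat \<phi> \<AA> V Y"
      and Z: "set_pmf Z \<subseteq> assignments \<AA> V" "sat \<psi> \<AA> V Z"
      by auto
    obtain r' Y' Z' where r': "r' \<in> {0..1}" "is_mixture r' X' Y' Z'"
      and Y': "set_pmf Y' \<subseteq> set_pmf Y" and Z': "set_pmf Z' \<subseteq> set_pmf Z"
      by (rule is_mixture_subteam[OF r Disj.prems(2)])
    have "sat \<phi> \<AA> V Y'" "sat \<psi> \<AA> V Z'"
      using Disj.IH(1)[OF _ Y' Y(2)] Disj.IH(2)[OF _ Z' Z(2)] Disj.prems(1) by simp_all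
    then show ?case using r' Y Z Y' Z' unfolding sat.simps by blast
  next
    case (Exi v \<phi>)
    from Exi.prems(3) obtain F where F: "\<forall>s\<in>set_pmf X. set_pmf (F s) \<subseteq> univ \<AA> (vsort v)"
      and sat: "sat \<phi> \<AA> (insert v V) (supplement X F v)"
      by auto
    have "sat \<phi> \<AA> (insert v V) (supplement X' F v)"
      by (rule Exi.IH[OF _ suppl[OF Exi.prems(2)] sat]) (use Exi.prems(1) in simp)
    then show ?case using F Exi.prems(2) unfolding sat.simps by blast
  next
    case (Uni v \<phi>)
    show ?case
      unfolding sat.simps duplicate_def
      by (rule Uni.IH[OF _ suppl[OF Uni.prems(2)]]) (use Uni.prems(1,3) in \<open>simp_all add: duplicate_def\<close>)
  next
    case (NewExi v \<phi>)
    from NewExi.prems(3) obtain B F where B: "finite B" "B \<noteq> {}"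
      and F: "\<forall>s\<in>set_pmf X. set_pmf (F s) \<subseteq> univ (expand \<AA> (vsort v) B) (vsort v)"
      and sat: "sat \<phi> (expand \<AA> (vsort v) B) (insert v V) (supplement X F v)"
      unfolding sat.simps by blast
    have "sat \<phi> (expand \<AA> (vsort v) B) (insert v V) (supplement X' F v)"
      by (rule NewExi.IH[OF _ suppl[OF NewExi.prems(2)] sat]) (use NewExi.prems(1) in simp)
    then show ?case using B F NewExi.prems(2) unfolding sat.simps by blast
  next
    case (NewUni v \<phi>)
    have "sat \<phi> (expand \<AA> (vsort v) B) (insert v V) (supplement X' F v)"
      if "sat \<phi> (expand \<AA> (vsort v) B) (insert v V) (supplement X F v)" for B F
      by (rule NewUni.IH[OF _ suppl[OF NewUni.prems(2)] that]) (use NewUni.prems(1) in simp)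
    then show ?case using NewUni.prems(3) unfolding sat.simps duplicate_def by blast
  }
qed auto

lemma sat_dep_intro:
  assumes fm: "is_fm (Exi x \<phi>) \<tau>" and fs: "finite_struct \<tau> \<AA>" and team: "is_team \<tau> \<AA> V X"
    and dl: "dependence_logic \<phi>" and zs: "set zs = fv (Exi x \<phi>)" and V: "fv (Exi x \<phi>) \<subseteq> V"
    and "sat (Exi x \<phi>) \<AA> V X"
  shows "sat (Exi x (Conj (Dep zs [x]) \<phi>)) \<AA> V X"
proof -
  from assms(7) obtain F where F: "\<forall>s\<in>set_pmf X. set_pmf (F s) \<subseteq> univ \<AA> (vsort x)"
    and sat: "sat \<phi> \<AA> (insert x V) (supplement X F x)"
    by auto
  \<comment> \<open>For each value of \<open>zs\<close>, one element is fixed among those that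
    \<open>F\<close> chooses with positive probability at some support assignment with this
    value.\<close>
  define g where "g as = (SOME a. \<exists>t\<in>set_pmf X. vals t zs = as \<and> a \<in> set_pmf (F t))" for as
  have g: "\<exists>t\<in>set_pmf X. vals t zs = vals s zs \<and> g (vals s zs) \<in> set_pmf (F t)"
    if "s \<in> set_pmf X" for s
  proof -
    obtain a where "a \<in> set_pmf (F s)" using set_pmf_not_empty[of "F s"] by blast
    then have "\<exists>a. \<exists>t\<in>set_pmf X. vals t zs = vals s zs \<and> a \<in> set_pmf (F t)" using that by blast
    then show ?thesis unfolding g_def by (rule someI_ex)
  qed
  let ?G = "\<lambda>s. return_pmf (g (vals s zs))"
  \<comment> \<open>At \<open>s\<close> the fixed element may come from a different assignment
    \<open>t\<close>, so the new support need not lie in the old one. The restriction forgets the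
    variables in which \<open>s\<close> and \<open>t\<close> may differ.\<close>
  let ?r = "\<lambda>s. s |` fv \<phi>"
  let ?Y = "supplement X F x" and ?Y' = "supplement X ?G x"
  have G: "\<forall>s\<in>set_pmf X. set_pmf (?G s) \<subseteq> univ \<AA> (vsort x)"
    using g F by fastforce
  have x: "vsort x \<in> sorts \<tau>" using fm by simp
  have teamY: "is_team \<tau> \<AA> (insert x V) ?Y" and teamY': "is_team \<tau> \<AA> (insert x V) ?Y'"
    by (rule is_team_supplement[OF team x F], rule is_team_supplement[OF team x G])
  have fvV: "fv \<phi> \<subseteq> insert x V" using V by auto
  have restr: "set_pmf (map_pmf ?r Y) \<subseteq> assignments \<AA> (fv \<phi>)"
    if "is_team \<tau> \<AA> (insert x V) Y" for Y
  proof -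
    have "?r s \<in> assignments \<AA> (fv \<phi>)" if "s \<in> assignments \<AA> (insert x V)" for s
      using that fvV by (auto simp: assignments_def)
    then show ?thesis using that by (auto simp: is_team_def)
  qed
  have rel: "rel_pmf (agrees id (fv \<phi>)) Y (map_pmf ?r Y)" for Y :: "'b assignment pmf"
    by (rule rel_pmf_agrees_map) (simp add: agrees_def)
  have sorts: "vsort ` fv \<phi> \<subseteq> sorts \<tau>" using fm is_fm_fv_sorts[of \<phi> \<tau>] by auto
  have "sat \<phi> \<AA> (fv \<phi>) (map_pmf ?r ?Y)"
    by (rule sat_local[OF _ fs sorts restr[OF teamY] _ fvV rel sat]) (use fm in simp_all)
  moreover have "set_pmf (map_pmf ?r ?Y') \<subseteq> set_pmf (map_pmf ?r ?Y)"
  proof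
    fix s' assume "s' \<in> set_pmf (map_pmf ?r ?Y')"
    then obtain s where s: "s \<in> set_pmf X" "s' = ?r (s(x \<mapsto> g (vals s zs)))"
      by (auto simp: supplement_def)
    from g[OF s(1)] obtain t where t: "t \<in> set_pmf X" "vals t zs = vals s zs"
      "g (vals s zs) \<in> set_pmf (F t)" by blast
    \<comment> \<open>Because \<open>zs\<close> lists all free variables of
      \<open>Exi x \<phi>\<close>, equal values of \<open>zs\<close> mean agreement on every free
      variable of \<open>\<phi>\<close> except \<open>x\<close>, which is overwritten.\<close>
    have "t u = s u" if "u \<in> fv \<phi>" "u \<noteq> x" for u
    proof -
      have "u \<in> set zs" "u \<in> V" using that zs V by auto
      then have "the (t u) = the (s u)" "u \<in> dom t" "u \<in> dom s"
        using t(1,2) s(1) team by (auto simp: vals_eq_iff is_team_def assignments_def)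
      then show ?thesis by auto
    qed
    then have "s' = ?r (t(x \<mapsto> g (vals s zs)))"
      unfolding s(2) by (auto simp: restrict_map_def fun_eq_iff)
    moreover have "t(x \<mapsto> g (vals s zs)) \<in> set_pmf ?Y"
      using t(1,3) by (auto simp: supplement_def)
    ultimately show "s' \<in> set_pmf (map_pmf ?r ?Y)"
      unfolding set_map_pmf by (rule image_eqI)
  qed
  ultimately have satY': "sat \<phi> \<AA> (fv \<phi>) (map_pmf ?r ?Y')"
    using sat_subteam[OF dl] by blast
  have "sat \<phi> \<AA> (insert x V) ?Y'"
    by (rule sat_local[OF _ fs _ _ fvV _ rel_pmf_agrees_sym[OF rel] satY'])
      (use fm teamY' in \<open>simp_all add: is_team_def\<close>)
  moreover have "determines ?Y' zs [x]"
  proof -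
    \<comment> \<open>Choosing \<open>x\<close> leaves the value of \<open>zs\<close> intact, so the
      argument of \<open>g\<close> can be read off from the supplemented assignment.\<close>
    have "x \<notin> set zs" using zs by simp
    then have "vals (s(x \<mapsto> a)) zs = vals s zs" for s :: "'b assignment" and a
      by (auto simp: vals_eq_iff)
    moreover have "vals (s(x \<mapsto> a)) [x] = [a]" for s :: "'b assignment" and a
      by (simp add: vals_def)
    ultimately show ?thesis by (auto simp: determines_def supplement_def)
  qed
  ultimately show ?thesis
    using G unfolding sat.simps cond_indep_self_iff by (intro exI[of _ ?G]) simp
qed


section \<open>Soundness\<close>

definition valid :: "'a itself \<Rightarrow> 'r vocab \<Rightarrow> 'r fm set \<Rightarrow> 'r fm \<Rightarrow> bool" where
  "valid _ \<tau> \<Sigma> \<phi> \<longleftrightarrow>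
     (\<forall>(\<AA> :: ('r, 'a) struct) V X. finite_struct \<tau> \<AA> \<longrightarrow> is_team \<tau> \<AA> V X \<longrightarrow>
        (\<forall>\<theta>\<in>\<Sigma>. fv \<theta> \<subseteq> V) \<longrightarrow> fv \<phi> \<subseteq> V \<longrightarrow> (\<forall>\<theta>\<in>\<Sigma>. sat \<theta> \<AA> V X) \<longrightarrow> sat \<phi> \<AA> V X)"

lemma validI:
  fixes \<tau> :: "'r vocab"
  assumes "\<And>(\<AA> :: ('r, 'a) struct) V X. finite_struct \<tau> \<AA> \<Longrightarrow> is_team \<tau> \<AA> V X \<Longrightarrow>
    (\<And>\<theta>. \<theta> \<in> \<Sigma> \<Longrightarrow> fv \<theta> \<subseteq> V) \<Longrightarrow> fv \<phi> \<subseteq> V \<Longrightarrow> (\<And>\<theta>. \<theta> \<in> \<Sigma> \<Longrightarrow> sat \<theta> \<AA> V X) \<Longrightarrow> sat \<phi> \<AA> V X"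
  shows "valid TYPE('a) \<tau> \<Sigma> \<phi>"
  using assms by (simp add: valid_def)

lemma validD:
  fixes \<AA> :: "('r, 'a) struct"
  assumes "valid TYPE('a) \<tau> \<Sigma> \<phi>" "finite_struct \<tau> \<AA>" "is_team \<tau> \<AA> V X"
    and "\<And>\<theta>. \<theta> \<in> \<Sigma> \<Longrightarrow> fv \<theta> \<subseteq> V" "fv \<phi> \<subseteq> V" "\<And>\<theta>. \<theta> \<in> \<Sigma> \<Longrightarrow> sat \<theta> \<AA> V X"
  shows "sat \<phi> \<AA> V X"
  using assms by (simp add: valid_def)

text \<open>Intermediate formulas of a derivation may have free variables outside the domain of the team;
  by locality the team may first be extended to those.\<close>

lemma valid_extend_domain:
  fixes \<tau> :: "'r vocab"
  assumes fm: "\<forall>\<theta>\<in>\<Sigma>. is_fm \<theta> \<tau>" "is_fm \<phi> \<tau>" and W: "finite W" "vsort ` W \<subseteq> sorts \<tau>"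
    and sat: "\<And>(\<AA> :: ('r, 'a) struct) V X. finite_struct \<tau> \<AA> \<Longrightarrow> is_team \<tau> \<AA> V X \<Longrightarrow> W \<subseteq> V \<Longrightarrow>
      (\<And>\<theta>. \<theta> \<in> \<Sigma> \<Longrightarrow> fv \<theta> \<subseteq> V) \<Longrightarrow> fv \<phi> \<subseteq> V \<Longrightarrow> (\<And>\<theta>. \<theta> \<in> \<Sigma> \<Longrightarrow> sat \<theta> \<AA> V X) \<Longrightarrow> sat \<phi> \<AA> V X"
  shows "valid TYPE('a) \<tau> \<Sigma> \<phi>"
proof (rule validI)
  fix \<AA> :: "('r, 'a) struct" and V X
  assume fs: "finite_struct \<tau> \<AA>" and team: "is_team \<tau> \<AA> V X"
    and V: "\<And>\<theta>. \<theta> \<in> \<Sigma> \<Longrightarrow> fv \<theta> \<subseteq> V" "fv \<phi> \<subseteq> V" and \<Sigma>: "\<And>\<theta>. \<theta> \<in> \<Sigma> \<Longrightarrow> sat \<theta> \<AA> V X"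
  let ?V = "V \<union> W"
  have sorts: "vsort ` ?V \<subseteq> sorts \<tau>" using team W by (auto simp: is_team_def)
  have "\<forall>s\<in>set_pmf X. \<exists>s'. s' \<in> assignments \<AA> ?V \<and> agrees id V s s'"
    using agreeing_assignment[OF _ fs sorts, of _ \<AA> V V id] team by (fastforce simp: is_team_def)
  then obtain e where e: "\<forall>s\<in>set_pmf X. e s \<in> assignments \<AA> ?V \<and> agrees id V s (e s)"
    by (rule bchoice[THEN exE])
  let ?X = "map_pmf e X"
  have team': "is_team \<tau> \<AA> ?V ?X"
    using team W e by (auto simp: is_team_def)
  have rel: "rel_pmf (agrees id V) X ?X"
    by (rule rel_pmf_agrees_map) (use e in blast)
  have "sat \<theta> \<AA> ?V ?X" if "\<theta> \<in> \<Sigma>" for \<theta>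
    by (rule sat_local[OF _ fs sorts _ _ V(1)[OF that] _ \<Sigma>[OF that]])
      (use fm that V(1)[OF that] team' rel in \<open>auto simp: is_team_def intro: rel_pmf_agrees_mono\<close>)
  then have sat': "sat \<phi> \<AA> ?V ?X"
    using V by (intro sat fs team') auto
  show "sat \<phi> \<AA> V X"
    by (rule sat_local[OF _ _ _ _ _ _ _ sat'])
      (use fm fs team V(2) rel in
        \<open>auto simp: is_team_def intro: rel_pmf_agrees_mono rel_pmf_agrees_sym\<close>)
qed

section \<open>Validity of the logical rules\<close>

lemma fv_sorts: "is_fm \<phi> \<tau> \<Longrightarrow> vsort ` fv \<phi> \<subseteq> sorts \<tau>"
  using is_fm_fv_sorts by blast

lemma valid_cut:
  fixes \<tau> :: "'r vocab"
  assumes fm: "\<forall>\<theta>\<in>\<Sigma>. is_fm \<theta> \<tau>" "is_fm \<eta> \<tau>" "is_fm \<phi> \<tau>"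
    and "valid TYPE('a) \<tau> \<Sigma> \<eta>" "valid TYPE('a) \<tau> (insert \<eta> \<Sigma>) \<phi>"
  shows "valid TYPE('a) \<tau> \<Sigma> \<phi>"
proof (rule valid_extend_domain[OF fm(1,3) finite_fv fv_sorts[OF fm(2)]])
  fix \<AA> :: "('r, 'a) struct" and V X
  assume *: "finite_struct \<tau> \<AA>" "is_team \<tau> \<AA> V X" "fv \<eta> \<subseteq> V"
    "\<And>\<theta>. \<theta> \<in> \<Sigma> \<Longrightarrow> fv \<theta> \<subseteq> V" "fv \<phi> \<subseteq> V" "\<And>\<theta>. \<theta> \<in> \<Sigma> \<Longrightarrow> sat \<theta> \<AA> V X"
  then have "sat \<eta> \<AA> V X" by (intro validD[OF assms(4)])
  then show "sat \<phi> \<AA> V X" using * by (intro validD[OF assms(5)]) auto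
qed

text \<open>A one-premise rule is a cut against a semantic consequence, which takes care of free
  variables of the premise that lie outside the team.\<close>

lemma valid_consequence:
  fixes \<tau> :: "'r vocab"
  assumes fm: "\<forall>\<theta>\<in>\<Sigma>. is_fm \<theta> \<tau>" "is_fm \<eta> \<tau>" "is_fm \<phi> \<tau>"
    and "valid TYPE('a) \<tau> \<Sigma> \<eta>"
    and step: "\<And>(\<AA> :: ('r, 'a) struct) V X. finite_struct \<tau> \<AA> \<Longrightarrow> is_team \<tau> \<AA> V X \<Longrightarrow>
      fv \<eta> \<subseteq> V \<Longrightarrow> fv \<phi> \<subseteq> V \<Longrightarrow> sat \<eta> \<AA> V X \<Longrightarrow> sat \<phi> \<AA> V X"
  shows "valid TYPE('a) \<tau> \<Sigma> \<phi>"
  using fm assms(4) by (rule valid_cut) (rule validI, rule step, auto)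

text \<open>Supplementing at \<open>x\<close>, which overwrites \<open>x\<close> if the team already
  has it, keeps the marginal on all other variables. Locality carries \<open>\<Sigma>\<close> to the
  supplemented team and \<open>\<psi>\<close> back.\<close>

lemma valid_exi_elim:
  fixes \<tau> :: "'r vocab"
  assumes fm: "\<forall>\<theta>\<in>\<Sigma>. is_fm \<theta> \<tau>" "is_fm (Exi x \<phi>) \<tau>" "is_fm \<psi> \<tau>"
    and x: "x \<notin> fv \<psi>" "\<forall>\<theta>\<in>\<Sigma>. x \<notin> fv \<theta>" and valid: "valid TYPE('a) \<tau> (insert \<phi> \<Sigma>) \<psi>"
  shows "valid TYPE('a) \<tau> (insert (Exi x \<phi>) \<Sigma>) \<psi>"
proof (rule validI)
  fix \<AA> :: "('r, 'a) struct" and V X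
  assume fs: "finite_struct \<tau> \<AA>" and team: "is_team \<tau> \<AA> V X"
    and V: "\<And>\<theta>. \<theta> \<in> insert (Exi x \<phi>) \<Sigma> \<Longrightarrow> fv \<theta> \<subseteq> V" "fv \<psi> \<subseteq> V"
    and \<Sigma>: "\<And>\<theta>. \<theta> \<in> insert (Exi x \<phi>) \<Sigma> \<Longrightarrow> sat \<theta> \<AA> V X"
  have "sat (Exi x \<phi>) \<AA> V X" using \<Sigma> by blast
  then obtain F where F: "\<forall>s\<in>set_pmf X. set_pmf (F s) \<subseteq> univ \<AA> (vsort x)"
    and sat: "sat \<phi> \<AA> (insert x V) (supplement X F x)"
    by auto
  have team': "is_team \<tau> \<AA> (insert x V) (supplement X F x)"
    using team _ F by (rule is_team_supplement) (use fm in simp)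
  have "sat \<theta> \<AA> (insert x V) (supplement X F x)" if "\<theta> \<in> \<Sigma>" for \<theta>
    by (rule sat_local[OF _ fs _ _ _ _ rel_pmf_agrees_supplement \<Sigma>[of \<theta>]])
      (use fm x team' that V(1)[of \<theta>] in \<open>auto simp: is_team_def\<close>)
  then have sat': "sat \<psi> \<AA> (insert x V) (supplement X F x)"
    using V(1)[of "Exi x \<phi>"] V(1) V(2) sat by (intro validD[OF valid fs team']) auto
  show "sat \<psi> \<AA> V X"
    by (rule sat_local[OF fm(3) fs _ _ V(2) _ rel_pmf_agrees_sym[OF rel_pmf_agrees_supplement] sat'])
      (use x team V(2) in \<open>auto simp: is_team_def\<close>)
qed

lemma valid_exi_intro:
  fixes \<tau> :: "'r vocab"
  assumes fm: "\<forall>\<theta>\<in>\<Sigma>. is_fm \<theta> \<tau>" "is_fm (subst y x \<phi>) \<tau>" "is_fm (Exi x \<phi>) \<tau>"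
    and y: "vsort y = vsort x" "free_for y x \<phi>" and valid: "valid TYPE('a) \<tau> \<Sigma> (subst y x \<phi>)"
  shows "valid TYPE('a) \<tau> \<Sigma> (Exi x \<phi>)"
\<comment> \<open>The variable \<open>y\<close> is added explicitly: if \<open>x\<close> is not free
  in \<open>\<phi>\<close>, \<open>y\<close> may be absent from the substituted formula, yet the
  witness still copies its value.\<close>
proof (rule valid_extend_domain[OF fm(1,3), of "insert y (fv (subst y x \<phi>))"])
  fix \<AA> :: "('r, 'a) struct" and V X
  assume *: "finite_struct \<tau> \<AA>" "is_team \<tau> \<AA> V X" "insert y (fv (subst y x \<phi>)) \<subseteq> V"
    "\<And>\<theta>. \<theta> \<in> \<Sigma> \<Longrightarrow> fv \<theta> \<subseteq> V" "fv (Exi x \<phi>) \<subseteq> V" "\<And>\<theta>. \<theta> \<in> \<Sigma> \<Longrightarrow> sat \<theta> \<AA> V X"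
  then have "sat (subst y x \<phi>) \<AA> V X" by (intro validD[OF valid]) auto
  then show "sat (Exi x \<phi>) \<AA> V X"
    using * by (intro sat_exi_of_subst[OF fm(3) _ _ y(1) _ y(2)]) auto
qed (use y fm(3) fv_sorts[OF fm(2)] in auto)

lemma valid_new_exi_intro1:
  fixes \<tau> :: "'r vocab"
  assumes fm: "\<forall>\<theta>\<in>\<Sigma>. is_fm \<theta> \<tau>" "is_fm (NewExi x \<phi>) \<tau>"
    and occ: "\<forall>\<theta>\<in>\<Sigma>. \<forall>u\<in>occ \<theta>. vsort u \<noteq> vsort x"
    and valid: "valid TYPE('a) (add_sort \<tau> (vsort x)) \<Sigma> (Exi x \<phi>)"
  shows "valid TYPE('a) \<tau> \<Sigma> (NewExi x \<phi>)"
proof (rule validI)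
  fix \<AA> :: "('r, 'a) struct" and V X
  assume fs: "finite_struct \<tau> \<AA>" and team: "is_team \<tau> \<AA> V X"
    and V: "\<And>\<theta>. \<theta> \<in> \<Sigma> \<Longrightarrow> fv \<theta> \<subseteq> V" "fv (NewExi x \<phi>) \<subseteq> V"
    and \<Sigma>: "\<And>\<theta>. \<theta> \<in> \<Sigma> \<Longrightarrow> sat \<theta> \<AA> V X"
  \<comment> \<open>The premise holds in every expansion, so any finite nonempty domain will do; a
    singleton is the simplest.\<close>
  let ?B = "{undefined :: 'a}"
  have x: "vsort x \<notin> sorts \<tau>" using fm(2) by simp
  have "sat (Exi x \<phi>) (expand \<AA> (vsort x) ?B) V X"
  proof (rule validD[OF valid])
    show "finite_struct (add_sort \<tau> (vsort x)) (expand \<AA> (vsort x) ?B)"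
      using fs by (rule finite_struct_expand) simp_all
    show "is_team (add_sort \<tau> (vsort x)) (expand \<AA> (vsort x) ?B) V X"
      using team x by (rule is_team_expand)
    show "sat \<theta> (expand \<AA> (vsort x) ?B) V X" if "\<theta> \<in> \<Sigma>" for \<theta>
      by (rule sat_expand[OF _ fs team V(1)[OF that] x _ \<Sigma>[OF that]]) (use fm occ that in auto)
  qed (use V in auto)
  then show "sat (NewExi x \<phi>) \<AA> V X"
    unfolding sat_NewExi by (intro exI[of _ ?B]) simp
qed

text \<open>The domain that witnesses the premise also witnesses the conclusion, as \<open>x\<close>
  and \<open>y\<close> share their sort; \<open>\<Sigma>\<close> survives the expansion because this
  sort does not occur in it.\<close>

lemma valid_new_exi_intro2:
  fixes \<tau> :: "'r vocab"
  assumes fm: "\<forall>\<theta>\<in>\<Sigma>. is_fm \<theta> \<tau>" "is_fm (NewExi x \<phi>) \<tau>"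
    and occ: "\<forall>\<theta>\<in>\<Sigma>. \<forall>u\<in>occ \<theta>. vsort u \<noteq> vsort x" and y: "vsort y = vsort x"
    and valid: "valid TYPE('a) (add_sort \<tau> (vsort x)) (insert (Exi x \<phi>) \<Sigma>) (Exi y \<psi>)"
  shows "valid TYPE('a) \<tau> (insert (NewExi x \<phi>) \<Sigma>) (NewExi y \<psi>)"
proof (rule validI)
  fix \<AA> :: "('r, 'a) struct" and V X
  assume fs: "finite_struct \<tau> \<AA>" and team: "is_team \<tau> \<AA> V X"
    and V: "\<And>\<theta>. \<theta> \<in> insert (NewExi x \<phi>) \<Sigma> \<Longrightarrow> fv \<theta> \<subseteq> V" "fv (NewExi y \<psi>) \<subseteq> V"
    and \<Sigma>: "\<And>\<theta>. \<theta> \<in> insert (NewExi x \<phi>) \<Sigma> \<Longrightarrow> sat \<theta> \<AA> V X"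
  have "sat (NewExi x \<phi>) \<AA> V X" using \<Sigma> by blast
  then obtain B where B: "finite B" "B \<noteq> {}" and sat: "sat (Exi x \<phi>) (expand \<AA> (vsort x) B) V X"
    unfolding sat_NewExi by blast
  have x: "vsort x \<notin> sorts \<tau>" using fm(2) by simp
  have "sat (Exi y \<psi>) (expand \<AA> (vsort x) B) V X"
  proof (rule validD[OF valid])
    show "finite_struct (add_sort \<tau> (vsort x)) (expand \<AA> (vsort x) B)"
      using fs B by (rule finite_struct_expand)
    show "is_team (add_sort \<tau> (vsort x)) (expand \<AA> (vsort x) B) V X"
      using team x by (rule is_team_expand)
    show "fv \<theta> \<subseteq> V" if "\<theta> \<in> insert (Exi x \<phi>) \<Sigma>" for \<theta>
      using that V(1)[of "NewExi x \<phi>"] V(1)[of \<theta>] by auto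
    show "sat \<theta> (expand \<AA> (vsort x) B) V X" if "\<theta> \<in> insert (Exi x \<phi>) \<Sigma>" for \<theta>
    proof (cases "\<theta> = Exi x \<phi>")
      case True
      then show ?thesis using sat by simp
    next
      case False
      then have "\<theta> \<in> \<Sigma>" using that by simp
      then show ?thesis
        by (intro sat_expand[OF _ fs team V(1) x _ \<Sigma>]) (use fm occ in auto)
    qed
  qed (use V(2) in simp)
  then show "sat (NewExi y \<psi>) \<AA> V X"
    unfolding sat_NewExi y using B by blast
qed

section \<open>Induction on derivations and the final theorem\<close>

lemma derives_sound:
  "derives \<tau> \<Sigma> \<phi> \<Longrightarrow> valid TYPE('a) \<tau> \<Sigma> \<phi>"
proof (induction rule: derives.induct)
  case (assumption \<Sigma> \<tau> \<phi>)
  then show ?case by (auto simp: valid_def)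
next
  case (monotonicity \<tau> \<Sigma> \<phi> \<Sigma>')
  then show ?case unfolding valid_def by blast
next
  case (cut \<tau> \<Sigma> \<theta> \<phi>)
  show ?case
    by (rule valid_cut[OF _ _ _ cut.IH])
      (use derives_is_fm[OF cut.hyps(1)] derives_is_fm[OF cut.hyps(2)] in auto)
next
  case (by_atom_axiom \<Sigma> \<tau> \<phi>)
  then show ?case by (intro validI sat_atom_axiom finite_team)
next
  case (by_atom_rule \<tau> \<Sigma> \<phi> \<psi>)
  show ?case
    by (rule valid_consequence[OF _ _ _ by_atom_rule.IH])
      (use derives_is_fm[OF by_atom_rule.hyps(1)] by_atom_rule.hyps in
        \<open>auto intro: sat_atom_rule finite_team\<close>)
next
  case (exi_elim \<tau> \<phi> \<Sigma> \<psi> x)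
  show ?case
    by (rule valid_exi_elim[OF _ _ _ _ _ exi_elim.IH])
      (use derives_is_fm[OF exi_elim.hyps(1)] exi_elim.hyps in auto)
next
  case (exi_intro \<tau> \<Sigma> y x \<phi>)
  show ?case
    by (rule valid_exi_intro[OF _ _ _ _ _ exi_intro.IH])
      (use derives_is_fm[OF exi_intro.hyps(1)] exi_intro.hyps in auto)
next
  case (conj_elim1 \<tau> \<Sigma> \<phi> \<psi>)
  show ?case
    by (rule valid_consequence[OF _ _ _ conj_elim1.IH])
      (use derives_is_fm[OF conj_elim1.hyps(1)] in auto)
next
  case (conj_elim2 \<tau> \<Sigma> \<phi> \<psi>)
  show ?case
    by (rule valid_consequence[OF _ _ _ conj_elim2.IH])
      (use derives_is_fm[OF conj_elim2.hyps(1)] in auto)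
next
  case (conj_intro \<tau> \<Sigma> \<phi> \<psi>)
  then show ?case by (simp add: valid_def)
next
  case (dep_intro \<tau> \<Sigma> x \<phi> zs)
  have fm: "is_fm (Exi x (Conj (Dep zs [x]) \<phi>)) \<tau>" "\<forall>\<theta>\<in>\<Sigma>. is_fm \<theta> \<tau>" "is_fm (Exi x \<phi>) \<tau>"
    using derives_is_fm[OF derives.dep_intro[OF dep_intro.hyps]] derives_is_fm[OF dep_intro.hyps(1)]
    by blast+
  show ?case
    by (rule valid_consequence[OF fm(2,3,1) dep_intro.IH],
        rule sat_dep_intro[OF fm(3) _ _ dep_intro.hyps(2,3)])
next
  case (new_exi_intro1 \<tau> x \<Sigma> \<phi>)
  show ?case
    by (rule valid_new_exi_intro1[OF _ _ _ new_exi_intro1.IH]) (use new_exi_intro1.hyps in blast)+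
next
  case (new_exi_intro2 \<tau> x \<phi> \<Sigma> y \<psi>)
  show ?case
    by (rule valid_new_exi_intro2[OF _ _ _ _ new_exi_intro2.IH]) (use new_exi_intro2.hyps in blast)+
qed

theorem corollary4p25:
  fixes \<tau> :: "'r vocab" and \<phi> \<psi> :: "'r fm"
  assumes "is_vocab \<tau>"
    and "is_fm \<phi> \<tau>" and "is_fm \<psi> \<tau>"
    and "derives \<tau> {\<phi>} \<psi>"
  shows "entails TYPE('a::infinite) \<tau> \<phi> \<psi>"
  using derives_sound[OF assms(4), where 'a = 'a]
  by (simp add: entails_def valid_def is_struct_def finite_struct_def)

end
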